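(* Assume the setting below. Suppose: (1) $\lambda>\chi$ is such that $\mu^{<\kappa}<\lambda$ for all $\mu<\lambda$ (or such that $\mathcal N$ is stable in $\mu$ for unboundedly many $\mu<\lambda$); (2) $M$ is a model such that for every $q\in S(M)$ there is a strictly increasing sequence of models $\langle M_i:i<\delta\rangle$ with: $\delta\ge\lambda$ a limit ordinal; $M=\bigcup_{i<\delta}M_i$; for all $i<\delta$, $M_i$ is $\chi^+$-saturated and $M_{i+1}$ realizes $q\restriction M_i$; and there exist a splitting-like notion $R$, some $i<\delta$, and $A\subseteq|M_i|$ of size at most $\chi_0$ such that $q$ does not $R$-split over $A$. Then $M$ is $\lambda$-saturated.
   Context: Setting: $\kappa$ infinite cardinal, $L$ a $(<\kappa)$-ary language, $\mathcal N$ a fixed $L$-structure; we work inside $\mathcal N$. Formulas are quantifier-free $L_{\kappa,\kappa}$; $\mathrm{tp}(\bar c/A)$ is the quantifier-free $L_{\kappa,\kappa}$-type in $\mathcal N$; $S^\alpha(A)$ the complete such types of length $\alpha$ over $A$ realized in $\mathcal N$, $S(A)=S^1(A)$; tuples have length $<\kappa$. A family $\mathcal S\subseteq\mathcal P(|\mathcal N|)$ of "models" is closed under unions of increasing chains and satisfies: if $A\subseteq B$, $A\in\mathcal S$, there is $A'\in\mathcal S$ with $A\subseteq A'\subseteq B$, $|A'|\le(|L|+2)^{<\kappa}+|A|$. $M$ is $\lambda$-saturated for types of length $\alpha$ if every $p\in S^\alpha(A)$ with $A\subseteq|M|$, $|A|<\lambda$, is realized in $M$; $\lambda$-saturated means for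 all lengths $<\kappa$. Standing assumption: for $\mu>(|L|+2)^{<\kappa}$, $\mu$-saturated for types of length one implies $\mu$-saturated. $\mathcal N$ is stable in $\mu$ if $|S(A)|\le\mu$ whenever $|A|\le\mu$. $\mathcal N$ has the order property of length $\theta$ if some formula $\phi(\bar x,\bar y)$ and tuples $\langle\bar a_i:i<\theta\rangle$ satisfy $\models\phi[\bar a_i,\bar a_j]$ iff $i<j$. Standing assumptions: $\chi_0\ge(|L|+2)^{<\kappa}$, $\mathcal N$ does not have the order property of length $\chi_0^+$, $\chi:=(2^{2^{\chi_0}})^+$. A set of formulas $p$ splits over $A$ if there are $\phi(\bar x,\bar b)\in p$ and $\bar b'$ with $\mathrm{tp}(\bar b'/A)=\mathrm{tp}(\bar b/A)$ and $\neg\phi(\bar x,\bar b')\in p$. A splitting-like notion is a relation $R(p,A)$ ("$p$ does not $R$-split over $A$"), for $p\in S^{<\infty}(B)$, $A\subseteq B$, such that: $A\subseteq A'\subseteq B_0\subseteq B$ and $R(p,A)$ imply $R(p\restriction B_0,A')$; if $A\subseteq|M|\subseteq B$, $M$ is $(|A|+(|L|+2)^{<\kappa})^+$-saturated, $q_1,q_2\in S^{<\infty}(B)$ with $R(q_\ell,A)$ and $q_1\restriction M=q_2\restriction M$, then $q_1=q_2$; and if $p\in S^{<\infty}(B)$ does not split over $A\subseteq B$ then $R(p,A)$.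
   Formalization: The index i with A ⊆ |M_i| is additionally required to leave a final segment {j : i ≤ j < δ} of order type at least λ; without this the claim fails, e.g. for δ = λ+ω and an equivalence relation with λ classes of size χ⁺ (λ > χ⁺). *)

theory Defs
  imports Main
begin

unbundle cardinal_syntax

text \<open>
  Cardinals are \<open>Card_order\<close> relations and ordinals are \<open>Well_order\<close> relations. An ordinal below
  the cardinal \<open>\<kappa>\<close> is represented by the element \<open>\<alpha> \<in> Field \<kappa>\<close> of which \<open>underS \<kappa> \<alpha>\<close> is the set of
  predecessors. A tuple of length \<open>\<alpha>\<close> is a partial function whose domain is \<open>underS \<kappa> \<alpha>\<close>.
\<close>


section \<open>Cardinal arithmetic\<close>

definition is_sup_cexp :: "'m rel \<Rightarrow> 'k rel \<Rightarrow> ('k \<Rightarrow> 'm) rel \<Rightarrow> bool" where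
  "is_sup_cexp \<mu> \<kappa> s \<longleftrightarrow>
     Card_order s \<and>
     (\<forall>\<theta>::'k rel. Card_order \<theta> \<and> \<theta> <o \<kappa> \<longrightarrow> \<mu> ^c \<theta> \<le>o s) \<and>
     (\<forall>s'::('k \<Rightarrow> 'm) rel. Card_order s' \<and>
        (\<forall>\<theta>::'k rel. Card_order \<theta> \<and> \<theta> <o \<kappa> \<longrightarrow> \<mu> ^c \<theta> \<le>o s') \<longrightarrow> s \<le>o s')"

text \<open>
  \<open>cexp_less \<mu> \<kappa>\<close> is \<open>\<mu>\<^sup><\<^sup>\<kappa>\<close>, the supremum of the powers of \<open>\<mu>\<close> with exponent a cardinal below \<open>\<kappa>\<close>.
  Every such exponent has a representative on the type of \<open>\<kappa>\<close>, and the supremum has one on the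
  type of \<open>\<mu> ^c \<kappa>\<close>.
\<close>
definition cexp_less :: "'m rel \<Rightarrow> 'k rel \<Rightarrow> ('k \<Rightarrow> 'm) rel" where
  "cexp_less \<mu> \<kappa> = (SOME s. is_sup_cexp \<mu> \<kappa> s)"

lemma is_sup_cexp_cexp_less:
  fixes \<mu> :: "'m rel" and \<kappa> :: "'k rel"
  assumes m: "Card_order \<mu>" and k: "Card_order \<kappa>"
  shows "is_sup_cexp \<mu> \<kappa> (cexp_less \<mu> \<kappa>)"
proof -
  let ?ub = "\<lambda>s::('k \<Rightarrow> 'm) rel. Card_order s \<and>
    (\<forall>\<theta>::'k rel. Card_order \<theta> \<and> \<theta> <o \<kappa> \<longrightarrow> \<mu> ^c \<theta> \<le>o s)"
  have "?ub |UNIV|"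
  proof (intro conjI allI impI)
    show "Card_order ( |UNIV :: ('k \<Rightarrow> 'm) set| )" by (rule card_of_Card_order)
    show "\<mu> ^c \<theta> \<le>o |UNIV :: ('k \<Rightarrow> 'm) set|" for \<theta> :: "'k rel"
      unfolding cexp_def by (rule card_of_mono1) simp
  qed
  then have "{s. ?ub s} \<noteq> {}" by blast
  then have "\<exists>s\<in>{s. ?ub s}. \<forall>s'\<in>{s. ?ub s}. s \<le>o s'"
    by (rule exists_minim_Card_order) blast
  then have "\<exists>s. is_sup_cexp \<mu> \<kappa> s"
    unfolding is_sup_cexp_def by blast
  then show ?thesis
    unfolding cexp_less_def by (rule someI_ex)
qed

definition chi :: "'c rel \<Rightarrow> (('c \<Rightarrow> bool) \<Rightarrow> bool) set rel" where
  "chi \<chi>\<^sub>0 = cardSuc (ctwo ^c (ctwo ^c \<chi>\<^sub>0))"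

definition limit_ord :: "'i rel \<Rightarrow> bool" where
  "limit_ord \<delta> \<longleftrightarrow> Well_order \<delta> \<and> Field \<delta> \<noteq> {} \<and> (\<forall>i\<in>Field \<delta>. aboveS \<delta> i \<noteq> {})"

text \<open>
  The ordinal \<open>\<delta> - i\<close>. In the theorem the base \<open>A \<subseteq> M\<^sub>i\<close> has to occur so early that \<open>\<delta> - i\<close> is still
  at least \<open>\<lambda>\<close>; this is automatic when \<open>\<delta>\<close> is a cardinal, or when \<open>i < \<lambda>\<close>, for instance for \<open>i = 0\<close>.
  With only \<open>\<delta> \<ge> \<lambda>\<close> the theorem fails, already for \<open>\<delta> = \<lambda> + \<omega>\<close> and \<open>N\<close> an equivalence relation
  (\<open>\<kappa> = \<omega>\<close>, \<open>\<chi>\<^sub>0 = \<omega>\<close>, \<open>\<lambda> > \<chi>\<^sup>+\<close>) with \<open>\<lambda>\<close> classes of size \<open>\<chi>\<^sup>+\<close>: let \<open>M\<close> be \<open>N\<close> without one element \<open>c\<close>,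
  and let \<open>K\<close> be the class of \<open>c\<close> in \<open>M\<close>. Take \<open>M\<^sub>i\<close>, \<open>i < \<lambda>\<close>, to be unions of \<open>\<chi>\<^sup>+ + |i|\<close> classes other
  than \<open>K\<close> with union \<open>M - K\<close>, and let the \<open>M\<^sub>\<lambda>\<^sub>+\<^sub>n\<close> contain \<open>M - K\<close> and all of \<open>K\<close> but countably many
  elements, adding one of these at each step. The type of \<open>c\<close> over \<open>M\<close> does not split over any
  \<open>{m}\<close> with \<open>m \<in> K \<inter> M\<^sub>\<lambda>\<close>, but its restriction to \<open>K\<close> is not realized in \<open>M\<close>.
\<close>
definition final_seg :: "'i rel \<Rightarrow> 'i \<Rightarrow> 'i rel" where
  "final_seg \<delta> i = Restr \<delta> (above \<delta> i)"


section \<open>Infinitary structures and quantifier-free formulas\<close>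

text \<open>
  A \<open>(<\<kappa>)\<close>-ary language together with a structure for it whose universe is the type \<open>'a\<close>.
  The symbols are the elements of \<open>funs\<close> and \<open>rels\<close>, so the language may be empty.
\<close>
record ('k, 'f, 'r, 'a) struc =
  kap :: "'k rel"
  funs :: "'f set"
  rels :: "'r set"
  farity :: "'f \<Rightarrow> 'k"
  rarity :: "'r \<Rightarrow> 'k"
  fint :: "'f \<Rightarrow> ('k \<rightharpoonup> 'a) \<Rightarrow> 'a"
  rint :: "'r \<Rightarrow> ('k \<rightharpoonup> 'a) \<Rightarrow> bool"

definition infinitary_structure :: "('k, 'f, 'r, 'a) struc \<Rightarrow> bool" where
  "infinitary_structure N \<longleftrightarrow>
     Card_order (kap N) \<and> infinite (Field (kap N)) \<and>
     (\<forall>f\<in>funs N. farity N f \<in> Field (kap N)) \<and>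
     (\<forall>r\<in>rels N. rarity N r \<in> Field (kap N))"

text \<open>The cardinal \<open>(|L| + 2)\<^sup><\<^sup>\<kappa>\<close>.\<close>
definition lang_card :: "('k, 'f, 'r, 'a) struc \<Rightarrow> ('k \<Rightarrow> ('f + 'r) + bool) rel" where
  "lang_card N = cexp_less (( |funs N| +c |rels N| ) +c ctwo) (kap N)"

datatype (dead 'k, dead 'f, trm_vars: 'v) trm =
  Var 'v
| Fn 'f "'k \<rightharpoonup> ('k, 'f, 'v) trm"

datatype (dead 'k, dead 'f, dead 'r, fm_vars: 'v) fm =
  Eq "('k, 'f, 'v) trm" "('k, 'f, 'v) trm"
| Rel 'r "'k \<rightharpoonup> ('k, 'f, 'v) trm"
| Neg "('k, 'f, 'r, 'v) fm"
| Conj "'k \<rightharpoonup> ('k, 'f, 'r, 'v) fm"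

inductive wf_trm :: "('k, 'f, 'r, 'a) struc \<Rightarrow> ('k, 'f, 'v) trm \<Rightarrow> bool" for N where
  "wf_trm N (Var v)"
| "f \<in> funs N \<Longrightarrow> dom ts = underS (kap N) (farity N f) \<Longrightarrow> \<forall>t\<in>ran ts. wf_trm N t \<Longrightarrow>
     wf_trm N (Fn f ts)"

inductive wf_fm :: "('k, 'f, 'r, 'a) struc \<Rightarrow> ('k, 'f, 'r, 'v) fm \<Rightarrow> bool" for N where
  "wf_trm N t \<Longrightarrow> wf_trm N u \<Longrightarrow> wf_fm N (Eq t u)"
| "r \<in> rels N \<Longrightarrow> dom ts = underS (kap N) (rarity N r) \<Longrightarrow> \<forall>t\<in>ran ts. wf_trm N t \<Longrightarrow>
     wf_fm N (Rel r ts)"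
| "wf_fm N \<phi> \<Longrightarrow> wf_fm N (Neg \<phi>)"
| "\<gamma> \<in> Field (kap N) \<Longrightarrow> dom \<phi>s = underS (kap N) \<gamma> \<Longrightarrow> \<forall>\<phi>\<in>ran \<phi>s. wf_fm N \<phi> \<Longrightarrow>
     wf_fm N (Conj \<phi>s)"

text \<open>
  The quantifier-free \<open>L\<^sub>\<kappa>\<^sub>,\<^sub>\<kappa>\<close>-formulas with variables in \<open>V\<close>. The bound on the number of variables
  is not automatic when \<open>\<kappa>\<close> is singular.
\<close>
definition qf_fms :: "('k, 'f, 'r, 'a) struc \<Rightarrow> 'v set \<Rightarrow> ('k, 'f, 'r, 'v) fm set" where
  "qf_fms N V = {\<phi>. wf_fm N \<phi> \<and> fm_vars \<phi> \<subseteq> V \<and> |fm_vars \<phi>| <o kap N}"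

primrec val :: "('k, 'f, 'r, 'a) struc \<Rightarrow> ('v \<Rightarrow> 'a) \<Rightarrow> ('k, 'f, 'v) trm \<Rightarrow> 'a" where
  "val N s (Var v) = s v"
| "val N s (Fn f ts) = fint N f (map_option (val N s) \<circ> ts)"

primrec sat :: "('k, 'f, 'r, 'a) struc \<Rightarrow> ('v \<Rightarrow> 'a) \<Rightarrow> ('k, 'f, 'r, 'v) fm \<Rightarrow> bool" where
  "sat N s (Eq t u) \<longleftrightarrow> val N s t = val N s u"
| "sat N s (Rel r ts) \<longleftrightarrow> rint N r (map_option (val N s) \<circ> ts)"
| "sat N s (Neg \<phi>) \<longleftrightarrow> \<not> sat N s \<phi>"
| "sat N s (Conj \<phi>s) \<longleftrightarrow> (\<forall>b\<in>ran (map_option (sat N s) \<circ> \<phi>s). b)"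


section \<open>Types\<close>

definition tuples :: "('k, 'f, 'r, 'a) struc \<Rightarrow> 'k \<Rightarrow> 'a set \<Rightarrow> ('k \<rightharpoonup> 'a) set" where
  "tuples N \<alpha> A = {c. dom c = underS (kap N) \<alpha> \<and> ran c \<subseteq> A}"

definition one_len :: "('k, 'f, 'r, 'a) struc \<Rightarrow> 'k" where
  "one_len N = (THE \<alpha>. \<alpha> \<in> Field (kap N) \<and> card (underS (kap N) \<alpha>) = 1)"

text \<open>
  A formula \<open>\<phi>(x, b)\<close> with parameters has variables of type \<open>'k + 'a\<close>: \<open>Inl i\<close> stands for the
  variable \<open>x\<^sub>i\<close> and \<open>Inr b\<close> for the parameter \<open>b\<close>.
\<close>
type_synonym ('k, 'f, 'r, 'a) pfm = "('k, 'f, 'r, 'k + 'a) fm"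

definition tp ::
  "('k, 'f, 'r, 'a) struc \<Rightarrow> ('k \<rightharpoonup> 'a) \<Rightarrow> 'a set \<Rightarrow> ('k, 'f, 'r, 'a) pfm set" where
  "tp N c A = {\<phi> \<in> qf_fms N (dom c <+> A). sat N (case_sum (the \<circ> c) id) \<phi>}"

definition types ::
  "('k, 'f, 'r, 'a) struc \<Rightarrow> 'k \<Rightarrow> 'a set \<Rightarrow> ('k, 'f, 'r, 'a) pfm set set" where
  "types N \<alpha> A = (\<lambda>c. tp N c A) ` tuples N \<alpha> UNIV"

definition all_types ::
  "('k, 'f, 'r, 'a) struc \<Rightarrow> 'a set \<Rightarrow> ('k, 'f, 'r, 'a) pfm set set" where
  "all_types N A = (\<Union>\<alpha>\<in>Field (kap N). types N \<alpha> A)"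

definition restr :: "('k, 'f, 'r, 'a) pfm set \<Rightarrow> 'a set \<Rightarrow> ('k, 'f, 'r, 'a) pfm set" where
  "restr p B = {\<phi> \<in> p. fm_vars \<phi> \<subseteq> UNIV <+> B}"

definition realizes ::
  "('k, 'f, 'r, 'a) struc \<Rightarrow> 'a set \<Rightarrow> 'k \<Rightarrow> 'a set \<Rightarrow> ('k, 'f, 'r, 'a) pfm set \<Rightarrow> bool" where
  "realizes N M \<alpha> A p \<longleftrightarrow> (\<exists>c\<in>tuples N \<alpha> M. tp N c A = p)"

definition saturated_len ::
  "('k, 'f, 'r, 'a) struc \<Rightarrow> 'l rel \<Rightarrow> 'k \<Rightarrow> 'a set \<Rightarrow> bool" where
  "saturated_len N \<mu> \<alpha> M \<longleftrightarrow>
     (\<forall>A p. A \<subseteq> M \<and> |A| <o \<mu> \<and> p \<in> types N \<alpha> A \<longrightarrow> realizes N M \<alpha> A p)"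

definition saturated :: "('k, 'f, 'r, 'a) struc \<Rightarrow> 'l rel \<Rightarrow> 'a set \<Rightarrow> bool" where
  "saturated N \<mu> M \<longleftrightarrow> (\<forall>\<alpha>\<in>Field (kap N). saturated_len N \<mu> \<alpha> M)"

definition stable_in :: "('k, 'f, 'r, 'a) struc \<Rightarrow> 'l rel \<Rightarrow> bool" where
  "stable_in N \<mu> \<longleftrightarrow> (\<forall>A. |A| \<le>o \<mu> \<longrightarrow> |types N (one_len N) A| \<le>o \<mu>)"

definition order_property :: "('k, 'f, 'r, 'a) struc \<Rightarrow> 'i rel \<Rightarrow> bool" where
  "order_property N \<theta> \<longleftrightarrow>
     (\<exists>\<alpha>\<in>Field (kap N).
      \<exists>\<phi>\<in>qf_fms N (underS (kap N) \<alpha> <+> underS (kap N) \<alpha>).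
      \<exists>a. (\<forall>i\<in>Field \<theta>. a i \<in> tuples N \<alpha> UNIV) \<and>
        (\<forall>i\<in>Field \<theta>. \<forall>j\<in>Field \<theta>.
           sat N (case_sum (the \<circ> a i) (the \<circ> a j)) \<phi> \<longleftrightarrow> (i, j) \<in> \<theta> \<and> i \<noteq> j))"


section \<open>Models\<close>

text \<open>
  The second clause is the standing assumption verbatim, with \<open>A \<in> \<S>\<close> (for which \<open>A' = A\<close> works)
  rather than the stronger Loewenheim-Skolem condition with \<open>B \<in> \<S>\<close>.
\<close>
definition model_family :: "('k, 'f, 'r, 'a) struc \<Rightarrow> 'a set set \<Rightarrow> bool" where
  "model_family N \<S> \<longleftrightarrow>
     (\<forall>C. C \<noteq> {} \<and> subset.chain \<S> C \<longrightarrow> \<Union>C \<in> \<S>) \<and>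
     (\<forall>A B. A \<subseteq> B \<and> A \<in> \<S> \<longrightarrow>
        (\<exists>A'\<in>\<S>. A \<subseteq> A' \<and> A' \<subseteq> B \<and> |A'| \<le>o lang_card N +c |A| ))"

text \<open>
  The type of \<open>\<mu>\<close> contains a representative of every cardinal up to the successor of
  \<open>max (|N|, (|L| + 2)\<^sup><\<^sup>\<kappa>)\<close>. From there on \<open>\<mu>\<close>-saturation no longer depends on \<open>\<mu>\<close>, so the
  assumption is stated for all cardinals.
\<close>
definition one_types_suffice :: "('k, 'f, 'r, 'a) struc \<Rightarrow> 'a set set \<Rightarrow> bool" where
  "one_types_suffice N \<S> \<longleftrightarrow>
     (\<forall>\<mu> :: ('a + ('k \<Rightarrow> ('f + 'r) + bool)) set rel. \<forall>M\<in>\<S>.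
        Card_order \<mu> \<and> lang_card N <o \<mu> \<and> saturated_len N \<mu> (one_len N) M \<longrightarrow> saturated N \<mu> M)"


section \<open>Splitting\<close>

text \<open>
  A formula \<open>\<phi>(x, y)\<close> has variables of type \<open>'k + 'k\<close>; \<open>subst_params b \<phi>\<close> is \<open>\<phi>(x, b)\<close>.
\<close>
definition subst_params ::
  "('k \<rightharpoonup> 'a) \<Rightarrow> ('k, 'f, 'r, 'k + 'k) fm \<Rightarrow> ('k, 'f, 'r, 'a) pfm" where
  "subst_params b \<phi> = map_fm (map_sum id (the \<circ> b)) \<phi>"

definition splits ::
  "('k, 'f, 'r, 'a) struc \<Rightarrow> ('k, 'f, 'r, 'a) pfm set \<Rightarrow> 'a set \<Rightarrow> bool" where
  "splits N p A \<longleftrightarrow>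
     (\<exists>\<beta>\<in>Field (kap N).
      \<exists>\<phi>\<in>qf_fms N (UNIV <+> underS (kap N) \<beta>).
      \<exists>b\<in>tuples N \<beta> UNIV. \<exists>b'\<in>tuples N \<beta> UNIV.
        tp N b' A = tp N b A \<and> subst_params b \<phi> \<in> p \<and> Neg (subst_params b' \<phi>) \<in> p)"

text \<open>
  \<open>R p A\<close> reads ``\<open>p\<close> does not \<open>R\<close>-split over \<open>A\<close>''. The base \<open>B\<close> of a type \<open>p\<close> is determined by \<open>p\<close>,
  since \<open>p\<close> contains \<open>b = b\<close> for exactly the \<open>b \<in> B\<close>.
\<close>
definition splitting_like ::
  "('k, 'f, 'r, 'a) struc \<Rightarrow> 'a set set \<Rightarrow>
    (('k, 'f, 'r, 'a) pfm set \<Rightarrow> 'a set \<Rightarrow> bool) \<Rightarrow> bool" where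
  "splitting_like N \<S> R \<longleftrightarrow>
     (\<forall>A A' B\<^sub>0 B p.
        A \<subseteq> A' \<and> A' \<subseteq> B\<^sub>0 \<and> B\<^sub>0 \<subseteq> B \<and> p \<in> all_types N B \<and> R p A \<longrightarrow>
        R (restr p B\<^sub>0) A') \<and>
     (\<forall>A M B q\<^sub>1 q\<^sub>2.
        A \<subseteq> M \<and> M \<subseteq> B \<and> M \<in> \<S> \<and> saturated N (cardSuc ( |A| +c lang_card N)) M \<and>
        q\<^sub>1 \<in> all_types N B \<and> q\<^sub>2 \<in> all_types N B \<and> R q\<^sub>1 A \<and> R q\<^sub>2 A \<and> restr q\<^sub>1 M = restr q\<^sub>2 M \<longrightarrow>
        q\<^sub>1 = q\<^sub>2) \<and>
     (\<forall>A B p. A \<subseteq> B \<and> p \<in> all_types N B \<and> \<not> splits N p A \<longrightarrow> R p A)"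

end

theory Submission
  imports Defs
begin

text \<open>
  Let \<open>c\<close> realize a type over \<open>M\<close>, and let \<open>a\<^sub>j \<in> M\<^sub>j\<^sub>+\<^sub>1\<close> realize the restriction of that type to \<open>M\<^sub>j\<close>. Along
  a segment of length \<open>\<chi>\<close> the absence of a long order, together with a count of the formulas, gives a
  small set \<open>A'\<close> inside some \<open>M\<^sub>l\<close> over which the type of \<open>c\<close> does not split on the union of the segment.
  For any \<open>b\<close> some \<open>a\<^sub>j\<close> has a type over \<open>M\<^sub>l b\<close> that does not split over \<open>A'\<close>, so uniqueness for \<open>R\<close>
  makes it agree with \<open>c\<close> there; hence the type of \<open>c\<close> does not split over \<open>A'\<close> on all of \<open>M\<close>. Then each
  formula over \<open>M\<close> is decided by all but at most \<open>\<chi>\<^sub>0\<close> of the \<open>a\<^sub>j\<close> as it is by \<open>c\<close>: otherwise copies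
  \<open>b\<^sub>j \<in> M\<^sub>j\<close> of its parameters over \<open>A'\<close> and the earlier \<open>a\<^sub>i\<close> give the order property. Since \<open>\<lambda>\<close>
  exceeds the number of formulas, or of types, over a set \<open>D\<close> of size below \<open>\<lambda>\<close>, some \<open>a\<^sub>j\<close> realizes
  the type of \<open>c\<close> over \<open>D\<close>.
\<close>

section \<open>Syntax and codes of formulas\<close>

text \<open>The notion \<open>R\<close> supplies uniqueness over saturated members of
  \<open>\<S>\<close> but no control over a change of parameters, so ordinary nonsplitting of the
  type of \<open>c\<close> has to be established before exceptions can be counted. The order
  property is refuted for one formula at a time, and its failure at
  \<open>cardSuc \<chi>\<^sub>0\<close> bounds by \<open>\<chi>\<^sub>0\<close> what a single
  formula costs, be it elements of a base or exceptional indices. The formulas together are bounded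
  only by \<open>exp2_chi0\<close>, and so is a base that serves all of them. This is the origin of
  \<open>chi\<close>: it is the successor of that bound, hence regular, so a base drawn from the
  union of a chain of length \<open>chi\<close> already lies in one of its members, and saturation
  beyond \<open>chi\<close> leaves room to copy parameters over such a base and the elements chosen
  so far. Nonsplitting found along the short segment concerns only parameters from its union;
  parameters elsewhere in M are the obstacle, and it is for them that uniqueness is invoked.\<close>

lemma ordLeq_strict_embedding:
  assumes "r \<le>o r'"
  obtains e where "\<And>i. i \<in> Field r \<Longrightarrow> e i \<in> Field r'"
    and "\<And>i j. (i, j) \<in> r \<Longrightarrow> i \<noteq> j \<Longrightarrow> (e i, e j) \<in> r' \<and> e i \<noteq> e j"
proof -
  obtain e where wo: "Well_order r" "Well_order r'" and e: "embed r r' e"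
    using assms unfolding ordLeq_def by blast
  have inj: "inj_on e (Field r)" using embed_inj_on[OF wo(1) e] .
  have comp: "compat r r' e" using embed_compat[OF e] .
  show ?thesis
  proof (rule that[of e])
    show "e i \<in> Field r'" if "i \<in> Field r" for i
      using embed_in_Field[OF e that] .
    show "(e i, e j) \<in> r' \<and> e i \<noteq> e j" if "(i, j) \<in> r" "i \<noteq> j" for i j
      using that comp inj FieldI1[OF that(1)] FieldI2[OF that(1)]
      unfolding compat_def inj_on_def by blast
  qed
qed

text \<open>Tuples, and the conjuncts of \<open>Conj\<close>, are indexed by initial segments of
  \<kappa>. Through this bijection any index set of size below \<kappa>, such as the variables of a
  formula, can take their place.\<close>

lemma card_less_bij_underS:
  assumes "Card_order k" "|W| <o k"
  obtains \<alpha> h where "\<alpha> \<in> Field k" "bij_betw h W (underS k \<alpha>)"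
proof -
  have wo: "Well_order k" using assms(1) card_order_on_well_order_on by blast
  obtain \<alpha> where a: "\<alpha> \<in> Field k" and iso: "|W| =o Restr k (underS k \<alpha>)"
    using ordLess_iff_ordIso_Restr[OF wo card_of_Well_order] assms(2) by blast
  have "|Field |W| | =o |Field (Restr k (underS k \<alpha>))|"
    using card_of_cong[OF iso] .
  moreover have "Field (Restr k (underS k \<alpha>)) = underS k \<alpha>"
    by (rule Field_Restr_ofilter[OF wo]) (simp add: wo wo_rel.underS_ofilter wo_rel_def)
  ultimately have "|W| =o |underS k \<alpha>|" by (simp add: Field_card_of)
  then show ?thesis using that a card_of_ordIso by blast
qed

text \<open>A well-order on more than \<open>c\<close> elements has type at least the successor
  cardinal of \<open>c\<close>. This turns a large set of bad indices into a sequence long enough to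
  contradict the failure of the order property.\<close>

lemma large_subset_cardSuc_embedding:
  assumes "Card_order c" "Well_order r" "J \<subseteq> Field r" "\<not> |J| \<le>o c"
  obtains e where "\<And>i. i \<in> Field (cardSuc c) \<Longrightarrow> e i \<in> J"
    and "\<And>i j. (i, j) \<in> cardSuc c \<Longrightarrow> i \<noteq> j \<Longrightarrow> (e i, e j) \<in> r \<and> e i \<noteq> e j"
proof -
  have "c <o |J|"
    using assms(4) not_ordLeq_iff_ordLess[of c "|J|"] card_of_Well_order
      card_order_on_well_order_on[OF assms(1)] by blast
  then have 1: "cardSuc c \<le>o |J|" using assms(1) by (simp add: cardSuc_least card_of_Card_order)
  have F: "Field (Restr r J) = J"
    using assms(2,3) by (simp add: Refl_Field_Restr2 wo_rel.REFL wo_rel_def)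
  then have "well_order_on J (Restr r J)"
    using Well_order_Restr[OF assms(2), of J] by simp
  then have "cardSuc c \<le>o Restr r J" using 1 card_of_least ordLeq_transitive by blast
  then obtain e where "\<And>i. i \<in> Field (cardSuc c) \<Longrightarrow> e i \<in> Field (Restr r J)"
    "\<And>i j. (i, j) \<in> cardSuc c \<Longrightarrow> i \<noteq> j \<Longrightarrow> (e i, e j) \<in> Restr r J \<and> e i \<noteq> e j"
    by (rule ordLeq_strict_embedding) blast
  then show ?thesis using that[of e] F by blast
qed

text \<open>The datatypes recurse through partial functions, so their set functions and induction
  hypotheses speak of options in the range of the argument function.\<close>

lemma Some_in_range: "g x = Some t \<Longrightarrow> Some t \<in> range g"
  by (metis rangeI)

lemma trm_vars_Fn: "ts x = Some t \<Longrightarrow> trm_vars t \<subseteq> trm_vars (Fn f ts)"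
  unfolding trm.set by (intro subsetI UN_I[OF Some_in_range]) auto

lemma fm_vars_Rel: "ts x = Some t \<Longrightarrow> trm_vars t \<subseteq> fm_vars (Rel r ts)"
  unfolding fm.set by (intro subsetI UN_I[OF Some_in_range]) auto

lemma fm_vars_Conj: "\<phi>s x = Some \<phi> \<Longrightarrow> fm_vars \<phi> \<subseteq> fm_vars (Conj \<phi>s)"
  unfolding fm.set by (intro subsetI UN_I[OF Some_in_range]) auto

section \<open>Satisfaction under change of assignment and renaming of variables\<close>

lemma val_cong: "(\<And>v. v \<in> trm_vars t \<Longrightarrow> s v = s' v) \<Longrightarrow> val N s t = val N s' t"
proof (induction t)
  case (Fn f ts)
  have "map_option (val N s) (ts x) = map_option (val N s') (ts x)" for x
  proof (cases "ts x")
    case (Some t)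
    have "val N s t = val N s' t"
      by (rule Fn.IH[OF Some_in_range[of ts, OF Some]])
        (simp, rule Fn.prems, erule subsetD[OF trm_vars_Fn[of ts, OF Some]])
    then show ?thesis using Some by simp
  qed simp
  then have "map_option (val N s) \<circ> ts = map_option (val N s') \<circ> ts" by (simp add: fun_eq_iff)
  then show ?case by simp
qed simp

lemma val_map: "val N s (map_trm f t) = val N (s \<circ> f) t"
proof (induction t)
  case (Fn g ts)
  have "map_option (val N s) (map_option (map_trm f) (ts x)) = map_option (val N (s \<circ> f)) (ts x)" for x
    using Fn.IH[OF Some_in_range[of ts]] by (cases "ts x") (simp_all only: option.map option.set_intros)
  then have "map_option (val N s) \<circ> (map_option (map_trm f) \<circ> ts) = map_option (val N (s \<circ> f)) \<circ> ts"
    unfolding fun_eq_iff o_apply[of _ ts] o_apply[of "map_option (val N s)"] by blast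
  then show ?case by (simp only: trm.map val.simps)
qed simp

lemma sat_cong: "(\<And>v. v \<in> fm_vars \<phi> \<Longrightarrow> s v = s' v) \<Longrightarrow> sat N s \<phi> = sat N s' \<phi>"
proof (induction \<phi>)
  case (Eq t u)
  then show ?case using val_cong[of t s s' N] val_cong[of u s s' N] by simp
next
  case (Rel r ts)
  have "map_option (val N s) (ts x) = map_option (val N s') (ts x)" for x
  proof (cases "ts x")
    case (Some t)
    have "val N s t = val N s' t"
      by (rule val_cong) (rule Rel.prems, erule subsetD[OF fm_vars_Rel[of ts, OF Some]])
    then show ?thesis using Some by simp
  qed simp
  then have "map_option (val N s) \<circ> ts = map_option (val N s') \<circ> ts" by (simp add: fun_eq_iff)
  then show ?case by simp
next
  case (Neg \<phi>)
  then show ?case by simp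
next
  case (Conj \<phi>s)
  have "map_option (sat N s) (\<phi>s x) = map_option (sat N s') (\<phi>s x)" for x
  proof (cases "\<phi>s x")
    case (Some t)
    have "sat N s t = sat N s' t"
      by (rule Conj.IH[OF Some_in_range[of \<phi>s, OF Some]])
        (simp, rule Conj.prems, erule subsetD[OF fm_vars_Conj[of \<phi>s, OF Some]])
    then show ?thesis using Some by simp
  qed simp
  then have "map_option (sat N s) \<circ> \<phi>s = map_option (sat N s') \<circ> \<phi>s" by (simp add: fun_eq_iff)
  then show ?case by simp
qed

lemma sat_map: "sat N s (map_fm f \<phi>) = sat N (s \<circ> f) \<phi>"
proof (induction \<phi>)
  case (Eq t u)
  then show ?case by (simp only: fm.map sat.simps val_map)
next
  case (Rel r ts)
  have "map_option (val N s) \<circ> (map_option (map_trm f) \<circ> ts) = map_option (val N (s \<circ> f)) \<circ> ts"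
    by (auto simp: fun_eq_iff option.map_comp val_map intro!: option.map_cong)
  then show ?case by (simp only: fm.map sat.simps)
next
  case (Neg \<phi>)
  then show ?case by (simp only: fm.map sat.simps)
next
  case (Conj \<phi>s)
  have "map_option (sat N s) (map_option (map_fm f) (\<phi>s x)) = map_option (sat N (s \<circ> f)) (\<phi>s x)" for x
    using Conj.IH[OF Some_in_range[of \<phi>s]] by (cases "\<phi>s x") (simp_all only: option.map option.set_intros)
  then have "map_option (sat N s) \<circ> (map_option (map_fm f) \<circ> \<phi>s) = map_option (sat N (s \<circ> f)) \<circ> \<phi>s"
    unfolding fun_eq_iff o_apply[of _ \<phi>s] o_apply[of "map_option (sat N s)"] by blast
  then show ?case by (simp only: fm.map sat.simps)
qed

lemma sat_Conj: "sat N s (Conj \<phi>s) \<longleftrightarrow> (\<forall>\<phi>\<in>ran \<phi>s. sat N s \<phi>)"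
  by (auto simp: ran_def)

lemma wf_trm_map: "wf_trm N t \<Longrightarrow> wf_trm N (map_trm f t)"
proof (induction rule: wf_trm.induct)
  case (2 g ts)
  show ?case unfolding trm.map
    by (rule wf_trm.intros) (use 2 in \<open>auto simp: ran_def dom_def\<close>)
qed (auto intro: wf_trm.intros)

lemma wf_fm_map: "wf_fm N \<phi> \<Longrightarrow> wf_fm N (map_fm f \<phi>)"
proof (induction rule: wf_fm.induct)
  case (1 t u)
  then show ?case by (auto intro: wf_fm.intros wf_trm_map)
next
  case (2 r ts)
  show ?case unfolding fm.map
    by (rule wf_fm.intros) (use 2 in \<open>auto simp: ran_def dom_def intro: wf_trm_map\<close>)
next
  case (3 \<phi>)
  then show ?case by (auto intro: wf_fm.intros)
next
  case (4 \<gamma> \<phi>s)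
  show ?case unfolding fm.map
    by (rule wf_fm.intros) (use 4 in \<open>auto simp: ran_def dom_def\<close>)
qed

lemma map_fm_in_qf_fms:
  assumes "\<phi> \<in> qf_fms N V" "f ` fm_vars \<phi> \<subseteq> V'"
  shows "map_fm f \<phi> \<in> qf_fms N V'"
  using assms card_of_image ordLeq_ordLess_trans
  by (fastforce simp: qf_fms_def fm.set_map wf_fm_map)

lemma Neg_in_qf_fms: "\<phi> \<in> qf_fms N V \<Longrightarrow> Neg \<phi> \<in> qf_fms N V"
  by (auto simp: qf_fms_def intro: wf_fm.intros)

lemma qf_fms_vars: "\<phi> \<in> qf_fms N V \<Longrightarrow> fm_vars \<phi> \<subseteq> V \<and> |fm_vars \<phi>| <o kap N"
  by (auto simp: qf_fms_def)

lemma qf_fms_restrict_vars: "\<phi> \<in> qf_fms N V \<Longrightarrow> fm_vars \<phi> \<subseteq> V' \<Longrightarrow> \<phi> \<in> qf_fms N V'"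
  by (auto simp: qf_fms_def)

text \<open>
  Terms and formulas are well-founded trees with fewer than \<open>\<kappa>\<close> branches at each node and are coded by
  their sets of labelled paths. This bounds their number even if \<open>\<kappa>\<close> is singular, when it can exceed
  \<open>(|L| + 2)\<^sup><\<^sup>\<kappa>\<close>.
\<close>
primrec trm_code :: "('k, 'f, 'v) trm \<Rightarrow> ('k list \<times> ('v + 'f)) set" where
  "trm_code (Var v) = {([], Inl v)}"
| "trm_code (Fn f ts) = insert ([], Inr f)
     {(s # p, y) | s p y. \<exists>X. (map_option trm_code \<circ> ts) s = Some X \<and> (p, y) \<in> X}"

lemma trm_code_root: "\<exists>y. ([], y) \<in> trm_code t"
  by (cases t) auto

text \<open>Every code contains an entry for its root, hence is nonempty. So the set of paths
  through a branch tells an undefined branch from a defined one and determines the code found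
  there.\<close>

lemma tree_code_option_inj:
  fixes code :: "'t \<Rightarrow> ('q list \<times> 'y) set"
  assumes root: "\<And>t. \<exists>y. ([], y) \<in> code t"
    and eq: "\<And>p y. (\<exists>X. map_option code a = Some X \<and> (p, y) \<in> X) \<longleftrightarrow>
                   (\<exists>X. map_option code b = Some X \<and> (p, y) \<in> X)"
    and inj: "\<And>t u. a = Some t \<Longrightarrow> code t = code u \<Longrightarrow> t = u"
  shows "a = b"
proof (cases a)
  case None
  show ?thesis
  proof (cases b)
    case (Some u)
    obtain y where "([], y) \<in> code u" using root by blast
    then show ?thesis using eq[of "[]" y] None Some by simp
  qed (simp add: None)
next
  case (Some t)
  obtain y where "([], y) \<in> code t" using root by blast
  then obtain u where u: "b = Some u" using eq[of "[]" y] Some by auto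
  have "(p, y) \<in> code t \<longleftrightarrow> (p, y) \<in> code u" for p y using eq[of p y] Some u by simp
  then have "code t = code u" by auto
  then show ?thesis using inj Some u by blast
qed

lemma trm_code_inj: "trm_code t = trm_code u \<Longrightarrow> t = u"
proof (induction t arbitrary: u)
  case (Var v)
  then show ?case by (cases u) auto
next
  case (Fn f ts)
  then obtain g us where u: "u = Fn g us" by (cases u) auto
  have "([], Inr f) \<in> trm_code (Fn f ts)" by simp
  then have "([], Inr f) \<in> trm_code (Fn g us)" using Fn.prems u by metis
  then have fg: "f = g" by simp
  have "ts s = us s" for s
  proof (rule tree_code_option_inj[of trm_code, OF trm_code_root])
    show "(\<exists>X. map_option trm_code (ts s) = Some X \<and> (p, y) \<in> X) \<longleftrightarrow>
          (\<exists>X. map_option trm_code (us s) = Some X \<and> (p, y) \<in> X)" for p y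
    proof -
      have "(s # p, y) \<in> trm_code (Fn f ts) \<longleftrightarrow> (s # p, y) \<in> trm_code (Fn g us)"
        using Fn.prems u by simp
      then show ?thesis by simp
    qed
    show "t = u" if "ts s = Some t" "trm_code t = trm_code u" for t u
      using Fn.IH[of "Some t" t u] that by (metis option.set_intros rangeI)
  qed
  then show ?case using u fg by auto
qed

lemma trm_code_subset:
  "wf_trm N t \<Longrightarrow> trm_vars t \<subseteq> V \<Longrightarrow> trm_code t \<subseteq> lists (Field (kap N)) \<times> (V <+> funs N)"
proof (induction rule: wf_trm.induct)
  case (2 f ts)
  have "(s # p, y) \<in> lists (Field (kap N)) \<times> (V <+> funs N)"
    if "ts s = Some t" "(p, y) \<in> trm_code t" for s p y t
  proof -
    have "trm_vars t \<subseteq> V" using 2(4) trm_vars_Fn[of ts, OF that(1)] by blast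
    moreover have "t \<in> ran ts" using that(1) by (auto simp: ran_def)
    ultimately have "trm_code t \<subseteq> lists (Field (kap N)) \<times> (V <+> funs N)" using 2(3) by blast
    moreover have "s \<in> Field (kap N)"
      using domI[of ts, OF that(1)] 2(2) underS_Field by fast
    ultimately show ?thesis using that(2) by auto
  qed
  moreover have "z = ([], Inr f) \<or> (\<exists>s p y t. z = (s # p, y) \<and> ts s = Some t \<and> (p, y) \<in> trm_code t)"
    if "z \<in> trm_code (Fn f ts)" for z using that by auto
  ultimately show ?case using 2(1) by blast
qed auto

text \<open>The step \<open>None\<close> descends below a negation, \<open>Some s\<close> to the
  conjunct with index \<open>s\<close>. An atomic formula is a leaf whose label contains the
  complete codes of its terms; labels are therefore themselves sets of paths.\<close>

primrec fm_code :: "('k, 'f, 'r, 'v) fm \<Rightarrow>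
    ('k option list \<times>
      ((('k list \<times> ('v + 'f)) set \<times> ('k list \<times> ('v + 'f)) set) +
       ('r \<times> ('k \<times> 'k list \<times> ('v + 'f)) set) + bool)) set" where
  "fm_code (Eq t u) = {([], Inl (trm_code t, trm_code u))}"
| "fm_code (Rel r ts) = {([], Inr (Inl (r,
     {(s, p, y) | s p y. \<exists>X. (map_option trm_code \<circ> ts) s = Some X \<and> (p, y) \<in> X})))}"
| "fm_code (Neg \<phi>) = insert ([], Inr (Inr True)) {(None # p, y) | p y. (p, y) \<in> fm_code \<phi>}"
| "fm_code (Conj \<phi>s) = insert ([], Inr (Inr False))
     {(Some s # p, y) | s p y. \<exists>X. (map_option fm_code \<circ> \<phi>s) s = Some X \<and> (p, y) \<in> X}"

lemma fm_code_root: "\<exists>y. ([], y) \<in> fm_code \<phi>"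
  by (cases \<phi>) auto

lemma fm_code_inj: "fm_code \<phi> = fm_code \<psi> \<Longrightarrow> \<phi> = \<psi>"
proof (induction \<phi> arbitrary: \<psi>)
  case (Eq t u)
  then show ?case by (cases \<psi>) (auto dest: trm_code_inj)
next
  case (Rel r ts)
  have 0: "([], Inr (Inl (r, {(s, p, y) | s p y. \<exists>X. (map_option trm_code \<circ> ts) s = Some X \<and> (p, y) \<in> X})))
     \<in> fm_code \<psi>" using Rel by auto
  then obtain us where u: "\<psi> = Rel r us" by (cases \<psi>) auto
  have eq: "{(s, p, y) | s p y. \<exists>X. (map_option trm_code \<circ> ts) s = Some X \<and> (p, y) \<in> X} =
    {(s, p, y) | s p y. \<exists>X. (map_option trm_code \<circ> us) s = Some X \<and> (p, y) \<in> X}" (is "?A = ?B")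
    using 0 unfolding u by simp
  have "ts s = us s" for s
  proof (rule tree_code_option_inj[of trm_code, OF trm_code_root])
    show "(\<exists>X. map_option trm_code (ts s) = Some X \<and> (p, y) \<in> X) \<longleftrightarrow>
          (\<exists>X. map_option trm_code (us s) = Some X \<and> (p, y) \<in> X)" for p y
    proof -
      have "(s, p, y) \<in> ?A \<longleftrightarrow> (s, p, y) \<in> ?B" using eq by simp
      then show ?thesis by simp
    qed
  qed (rule trm_code_inj)
  then show ?case using u by auto
next
  case (Neg \<phi>)
  have "([], Inr (Inr True)) \<in> fm_code \<psi>" using Neg.prems by auto
  then obtain \<psi>' where u: "\<psi> = Neg \<psi>'" by (cases \<psi>) auto
  have "(p, y) \<in> fm_code \<phi> \<longleftrightarrow> (p, y) \<in> fm_code \<psi>'" for p y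
  proof -
    have "(None # p, y) \<in> fm_code (Neg \<phi>) \<longleftrightarrow> (None # p, y) \<in> fm_code (Neg \<psi>')"
      using Neg.prems u by simp
    then show ?thesis by simp
  qed
  then have "fm_code \<phi> = fm_code \<psi>'" by auto
  then show ?case using Neg.IH u by blast
next
  case (Conj \<phi>s)
  have "([], Inr (Inr False)) \<in> fm_code \<psi>" using Conj.prems by auto
  then obtain \<psi>s where u: "\<psi> = Conj \<psi>s" by (cases \<psi>) auto
  have "\<phi>s s = \<psi>s s" for s
  proof (rule tree_code_option_inj[of fm_code, OF fm_code_root])
    show "(\<exists>X. map_option fm_code (\<phi>s s) = Some X \<and> (p, y) \<in> X) \<longleftrightarrow>
          (\<exists>X. map_option fm_code (\<psi>s s) = Some X \<and> (p, y) \<in> X)" for p y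
    proof -
      have "(Some s # p, y) \<in> fm_code (Conj \<phi>s) \<longleftrightarrow> (Some s # p, y) \<in> fm_code (Conj \<psi>s)"
        using Conj.prems u by simp
      then show ?thesis by simp
    qed
    show "t = u" if "\<phi>s s = Some t" "fm_code t = fm_code u" for t u
      using Conj.IH[of "Some t" t u] that by (metis option.set_intros rangeI)
  qed
  then show ?case using u by auto
qed

lemma fm_code_subset:
  fixes N :: "('k, 'f, 'r, 'a) struc" and V :: "'v set"
  defines "L \<equiv> Pow (lists (Field (kap N)) \<times> (V <+> funs N))"
  assumes "wf_fm N \<phi>" "fm_vars \<phi> \<subseteq> V"
  shows "fm_code \<phi> \<subseteq> lists (insert None (Some ` Field (kap N))) \<times>
    ((L \<times> L) <+> ((rels N \<times> Pow (Field (kap N) \<times> lists (Field (kap N)) \<times> (V <+> funs N))) <+> UNIV))"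
    (is "_ \<subseteq> ?R")
  using assms(2,3)
proof (induction rule: wf_fm.induct)
  case (1 t u)
  then have "trm_code t \<in> L" "trm_code u \<in> L"
    unfolding L_def using trm_code_subset[of N t V] trm_code_subset[of N u V] by auto
  then show ?case by auto
next
  case (2 r ts)
  have "(s, p, y) \<in> Field (kap N) \<times> lists (Field (kap N)) \<times> (V <+> funs N)"
    if "ts s = Some t" "(p, y) \<in> trm_code t" for s p y t
  proof -
    have "trm_vars t \<subseteq> V" using 2(4) fm_vars_Rel[of ts, OF that(1), where r = r] by blast
    moreover have "t \<in> ran ts" using that(1) by (auto simp: ran_def)
    ultimately have "trm_code t \<subseteq> lists (Field (kap N)) \<times> (V <+> funs N)"
      using 2(3) trm_code_subset by blast
    moreover have "s \<in> Field (kap N)"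
      using domI[of ts, OF that(1)] 2(2) underS_Field by fast
    ultimately show ?thesis using that(2) by auto
  qed
  moreover have "\<exists>s p y t. z = (s, p, y) \<and> ts s = Some t \<and> (p, y) \<in> trm_code t"
    if "z \<in> {(s, p, y) | s p y. \<exists>X. (map_option trm_code \<circ> ts) s = Some X \<and> (p, y) \<in> X}" for z
    using that by auto
  ultimately have "{(s, p, y) | s p y. \<exists>X. (map_option trm_code \<circ> ts) s = Some X \<and> (p, y) \<in> X}
    \<subseteq> Field (kap N) \<times> lists (Field (kap N)) \<times> (V <+> funs N)" by blast
  then show ?case using 2(1) by auto
next
  case (3 \<phi>)
  have step: "(None # p, y) \<in> ?R" if "(p, y) \<in> fm_code \<phi>" for p y
  proof -
    have "(p, y) \<in> ?R" using 3 that by auto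
    then show ?thesis by auto
  qed
  have parts: "z = ([], Inr (Inr True)) \<or> (\<exists>p y. z = (None # p, y) \<and> (p, y) \<in> fm_code \<phi>)"
    if "z \<in> fm_code (Neg \<phi>)" for z using that by auto
  have root: "([], Inr (Inr True)) \<in> ?R" by auto
  show ?case
    by (rule subsetI, drule parts, elim disjE exE conjE; hypsubst) (rule root, rule step)
next
  case (4 \<gamma> \<phi>s)
  have step: "(Some s # p, y) \<in> ?R" if "\<phi>s s = Some t" "(p, y) \<in> fm_code t" for s p y t
  proof -
    have "fm_vars t \<subseteq> V" using 4(4) fm_vars_Conj[of \<phi>s, OF that(1)] by blast
    moreover have "t \<in> ran \<phi>s" using that(1) by (auto simp: ran_def)
    ultimately have "fm_code t \<subseteq> ?R" using 4(3) by blast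
    then have "(p, y) \<in> ?R" using that(2) by blast
    moreover have "s \<in> Field (kap N)"
      using domI[of \<phi>s, OF that(1)] 4(2) underS_Field by fast
    ultimately show ?thesis by auto
  qed
  have parts: "z = ([], Inr (Inr False)) \<or>
      (\<exists>s p y \<phi>. z = (Some s # p, y) \<and> \<phi>s s = Some \<phi> \<and> (p, y) \<in> fm_code \<phi>)"
    if "z \<in> fm_code (Conj \<phi>s)" for z using that by auto
  have root: "([], Inr (Inr False)) \<in> ?R" by auto
  show ?case
    by (rule subsetI, drule parts, elim disjE exE conjE; hypsubst) (rule root, rule step)
qed

section \<open>Types and the order property\<close>

lemma card_Pow_le_cexp:
  assumes "|A| \<le>o r" "Card_order r"
  shows "|Pow A| \<le>o ctwo ^c r"
proof -
  have "|A| \<le>o |Field r|"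
    by (rule ordLeq_ordIso_trans[OF assms(1) ordIso_symmetric[OF card_of_Field_ordIso[OF assms(2)]]])
  then obtain f where f: "inj_on f A" "f ` A \<subseteq> Field r"
    unfolding card_of_ordLeq[symmetric] by blast
  then have "inj_on (image f) (Pow A)" "image f ` Pow A \<subseteq> Pow (Field r)"
    by (auto simp: inj_on_image_Pow)
  then have "|Pow A| \<le>o |Pow (Field r)|" unfolding card_of_ordLeq[symmetric] by blast
  also have "|Pow (Field r)| =o ctwo ^c r"
    unfolding ctwo_def cexp_def Field_card_of by (rule card_of_Pow_Func)
  finally show ?thesis .
qed

lemma finite_Cinfinite_bound: "finite A \<Longrightarrow> Cinfinite r \<Longrightarrow> |A| <o r"
  by (rule Cfinite_ordLess_Cinfinite) (simp_all add: cfinite_def Field_card_of card_of_card_order_on)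

lemma card_lists_le:
  assumes "|A| \<le>o r" "Cinfinite r"
  shows "|lists A| \<le>o r"
proof -
  have co: "Card_order r" and inf: "infinite (Field r)"
    using assms(2) by (auto simp: cinfinite_def)
  have n: "|{xs \<in> lists A. length xs = n}| \<le>o r" for n
  proof (induction n)
    case 0
    show ?case by (rule ordLess_imp_ordLeq[OF finite_Cinfinite_bound[OF _ assms(2)]]) simp
  next
    case (Suc n)
    have "{xs \<in> lists A. length xs = Suc n} \<subseteq> (\<lambda>(x, xs). x # xs) ` (A \<times> {xs \<in> lists A. length xs = n})"
      by (auto simp: length_Suc_conv image_iff)
    then have "|{xs \<in> lists A. length xs = Suc n}| \<le>o |A \<times> {xs \<in> lists A. length xs = n}|"
      by (rule ordLeq_transitive[OF card_of_mono1 card_of_image])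
    also have "|A \<times> {xs \<in> lists A. length xs = n}| \<le>o r"
      using card_of_Times_ordLeq_infinite_Field[OF inf assms(1) Suc.IH co] .
    finally show ?case .
  qed
  have "|UNIV :: nat set| \<le>o r"
    by (rule ordIso_ordLeq_trans[OF card_of_nat natLeq_ordLeq_cinfinite[OF assms(2)]])
  then have "|\<Union>n\<in>(UNIV::nat set). {xs \<in> lists A. length xs = n}| \<le>o r"
    by (rule UNION_Cinfinite_bound[OF _ _ assms(2)]) (rule ballI, rule n)
  moreover have "lists A = (\<Union>n. {xs \<in> lists A. length xs = n})" by auto
  ultimately show ?thesis by simp
qed

lemma Plus_Cinfinite_bound: "|A| \<le>o r \<Longrightarrow> |B| \<le>o r \<Longrightarrow> Cinfinite r \<Longrightarrow> |A <+> B| \<le>o r"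
  using card_of_Plus_ordLeq_infinite_Field[of r A B] by (simp add: cinfinite_def)

lemma Times_Cinfinite_bound: "|A| \<le>o r \<Longrightarrow> |B| \<le>o r \<Longrightarrow> Cinfinite r \<Longrightarrow> |A \<times> B| \<le>o r"
  using card_of_Times_ordLeq_infinite_Field[of r A B] by (simp add: cinfinite_def)

lemma Cinfinite_ordLeq_trans: "Cinfinite r \<Longrightarrow> r \<le>o r' \<Longrightarrow> Card_order r' \<Longrightarrow> Cinfinite r'"
  using cinfinite_mono[of r r'] by simp

text \<open>The families are indexed by an arbitrary \<open>W\<close> instead of an initial segment
  of \<kappa>, so that the variables of a formula can serve as indices as they stand. The link to
  \<open>tp\<close> is \<open>tp_eq_iff_eqv\<close>.\<close>

definition eqv :: "('k, 'f, 'r, 'a) struc \<Rightarrow> 'a set \<Rightarrow> 'w set \<Rightarrow> ('w \<Rightarrow> 'a) \<Rightarrow> ('w \<Rightarrow> 'a) \<Rightarrow> bool" where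
  "eqv N A W b b' \<longleftrightarrow>
     (\<forall>\<theta>\<in>qf_fms N (W <+> A). sat N (case_sum b id) \<theta> \<longleftrightarrow> sat N (case_sum b' id) \<theta>)"

abbreviation same_type :: "('k, 'f, 'r, 'a) struc \<Rightarrow> 'a set \<Rightarrow> 'a \<Rightarrow> 'a \<Rightarrow> bool" where
  "same_type N A a a' \<equiv> eqv N A (UNIV :: unit set) (\<lambda>_. a) (\<lambda>_. a')"

lemma eqv_sym: "eqv N A W b b' \<Longrightarrow> eqv N A W b' b"
  by (simp add: eqv_def)

lemma eqv_trans: "eqv N A W b b' \<Longrightarrow> eqv N A W b' b'' \<Longrightarrow> eqv N A W b b''"
  by (simp add: eqv_def)

text \<open>Rename each variable either to an index in \<open>W\<close> or to the parameter it
  denotes under both assignments. The renaming may identify variables, and satisfaction commutes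
  with it, so the result is a formula tested by \<open>eqv\<close>.\<close>

lemma eqv_sat:
  assumes e: "eqv N A W b b'" and psi: "\<psi> \<in> qf_fms N V"
    and s: "\<And>v. v \<in> fm_vars \<psi> \<Longrightarrow> (\<exists>w\<in>W. s v = b w \<and> s' v = b' w) \<or> s v = s' v \<and> s v \<in> A"
  shows "sat N s \<psi> \<longleftrightarrow> sat N s' \<psi>"
proof -
  define f where "f v = (if s v = s' v \<and> s v \<in> A then Inr (s v)
    else Inl (SOME w. w \<in> W \<and> s v = b w \<and> s' v = b' w))" for v
  have f: "f v \<in> W <+> A \<and> case_sum b id (f v) = s v \<and> case_sum b' id (f v) = s' v"
    if v: "v \<in> fm_vars \<psi>" for v
  proof (cases "s v = s' v \<and> s v \<in> A")
    case False
    then have "\<exists>w. w \<in> W \<and> s v = b w \<and> s' v = b' w" using s[OF v] by blast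
    from someI_ex[OF this] show ?thesis using False by (auto simp: f_def)
  qed (auto simp: f_def)
  have "map_fm f \<psi> \<in> qf_fms N (W <+> A)"
    by (rule map_fm_in_qf_fms[OF psi], rule image_subsetI) (rule conjunct1[OF f])
  then have "sat N (case_sum b id \<circ> f) \<psi> \<longleftrightarrow> sat N (case_sum b' id \<circ> f) \<psi>"
    using bspec[OF e[unfolded eqv_def], of "map_fm f \<psi>"] unfolding sat_map by blast
  moreover have "sat N (case_sum b id \<circ> f) \<psi> \<longleftrightarrow> sat N s \<psi>"
    "sat N (case_sum b' id \<circ> f) \<psi> \<longleftrightarrow> sat N s' \<psi>"
    by (rule sat_cong; simp add: f)+
  ultimately show ?thesis by simp
qed

lemma eqv_reindex:
  assumes e: "eqv N A W b b'"
    and s: "\<And>v. v \<in> V \<Longrightarrow> (\<exists>w\<in>W. s v = b w \<and> s' v = b' w) \<or> s v = s' v \<and> s v \<in> A"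
    and A: "A' \<subseteq> A"
  shows "eqv N A' V s s'"
  unfolding eqv_def
proof
  fix \<theta> assume t: "\<theta> \<in> qf_fms N (V <+> A')"
  show "sat N (case_sum s id) \<theta> \<longleftrightarrow> sat N (case_sum s' id) \<theta>"
  proof (rule eqv_sat[OF e t])
    fix v assume "v \<in> fm_vars \<theta>"
    then consider x where "x \<in> V" "v = Inl x" | y where "y \<in> A'" "v = Inr y"
      using qf_fms_vars[OF t] by blast
    then show "(\<exists>w\<in>W. case_sum s id v = b w \<and> case_sum s' id v = b' w) \<or>
        case_sum s id v = case_sum s' id v \<and> case_sum s id v \<in> A"
    proof cases
      case 1
      then show ?thesis using s[of x] by simp
    next
      case 2
      then show ?thesis using A by auto
    qed
  qed
qed

lemma eqv_mono: "eqv N A W b b' \<Longrightarrow> A' \<subseteq> A \<Longrightarrow> W' \<subseteq> W \<Longrightarrow> eqv N A' W' b b'"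
  by (erule eqv_reindex) blast+

lemma tp_eq_iff_eqv:
  assumes "b \<in> tuples N \<beta> UNIV" "b' \<in> tuples N \<beta> UNIV"
  shows "tp N b A = tp N b' A \<longleftrightarrow> eqv N A (underS (kap N) \<beta>) (the \<circ> b) (the \<circ> b')"
proof -
  have "dom b = underS (kap N) \<beta>" "dom b' = underS (kap N) \<beta>"
    using assms unfolding tuples_def by blast+
  then have "\<phi> \<in> tp N b A \<longleftrightarrow>
      \<phi> \<in> qf_fms N (underS (kap N) \<beta> <+> A) \<and> sat N (case_sum (the \<circ> b) id) \<phi>"
    "\<phi> \<in> tp N b' A \<longleftrightarrow>
      \<phi> \<in> qf_fms N (underS (kap N) \<beta> <+> A) \<and> sat N (case_sum (the \<circ> b') id) \<phi>" for \<phi>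
    by (simp_all only: tp_def mem_Collect_eq)
  then show ?thesis unfolding eqv_def set_eq_iff by metis
qed

lemma restr_tp: "B\<^sub>0 \<subseteq> B \<Longrightarrow> restr (tp N c B) B\<^sub>0 = tp N c B\<^sub>0"
  unfolding restr_def tp_def qf_fms_def by blast

text \<open>The form in which saturation is applied: a short family is copied into \<open>P\<close>
  without changing its type over a small subset of \<open>P\<close>.\<close>

lemma saturated_eqv:
  fixes N :: "('k, 'f, 'r, 'a) struc" and b :: "'w \<Rightarrow> 'a"
  assumes N: "Card_order (kap N)" and sat: "saturated N \<mu> P"
    and X: "X \<subseteq> P" "|X| <o \<mu>" and W: "|W| <o kap N"
  obtains b' where "eqv N X W b b'" "b' ` W \<subseteq> P"
proof -
  obtain \<alpha> h where a: "\<alpha> \<in> Field (kap N)" and h: "bij_betw h W (underS (kap N) \<alpha>)"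
    using card_less_bij_underS[OF N W] by blast
  define c where "c s = (if s \<in> underS (kap N) \<alpha> then Some (b (inv_into W h s)) else None)" for s
  have c: "c \<in> tuples N \<alpha> UNIV" by (auto simp: tuples_def c_def dom_def)
  then have "tp N c X \<in> types N \<alpha> X" by (auto simp: types_def)
  then have "realizes N P \<alpha> X (tp N c X)"
    using sat a X by (auto simp: saturated_def saturated_len_def)
  then obtain c' where c': "c' \<in> tuples N \<alpha> P" and tp: "tp N c' X = tp N c X"
    by (auto simp: realizes_def)
  have c'': "c' \<in> tuples N \<alpha> UNIV" using c' by (auto simp: tuples_def)
  have hW: "h w \<in> underS (kap N) \<alpha>" if "w \<in> W" for w using h that by (auto simp: bij_betw_def)
  have ch: "(the \<circ> c) (h w) = b w" if "w \<in> W" for w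
    using h that hW by (simp add: c_def bij_betw_def)
  have "eqv N X W b (the \<circ> c' \<circ> h)"
    by (rule eqv_reindex[OF iffD1[OF tp_eq_iff_eqv[OF c c''] tp[symmetric]]]) (use hW ch in \<open>auto intro!: bexI\<close>)
  moreover have "(the \<circ> c' \<circ> h) ` W \<subseteq> P"
  proof
    fix y assume "y \<in> (the \<circ> c' \<circ> h) ` W"
    then obtain w where w: "w \<in> W" "y = the (c' (h w))" by auto
    then have "h w \<in> dom c'" using hW c' by (simp only: tuples_def mem_Collect_eq)
    then have "c' (h w) = Some y" using w by auto
    then show "y \<in> P" using ranI[of c'] c' unfolding tuples_def by blast
  qed
  ultimately show ?thesis using that by blast
qed

text \<open>\<open>order_property\<close> asks for a single sequence of tuples of one length. Each
  tuple here lists \<open>u i\<close> and \<open>v i\<close> together, indexed by all variables of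
  \<open>\<theta>\<close>; the renamed formula reads the left part of the first tuple and the right
  part of the second.\<close>

lemma order_propertyI:
  fixes N :: "('k, 'f, 'r, 'a) struc" and \<theta> :: "('k, 'f, 'r, 'v + 'w) fm"
  assumes N: "Card_order (kap N)" and t: "\<theta> \<in> qf_fms N V"
    and ord: "\<And>i j. i \<in> Field \<rho> \<Longrightarrow> j \<in> Field \<rho> \<Longrightarrow>
        sat N (case_sum (u i) (v j)) \<theta> \<longleftrightarrow> (i, j) \<in> \<rho> \<and> i \<noteq> j"
  shows "order_property N \<rho>"
proof -
  let ?W = "fm_vars \<theta>"
  obtain \<alpha> h where a: "\<alpha> \<in> Field (kap N)" and h: "bij_betw h ?W (underS (kap N) \<alpha>)"
    by (rule card_less_bij_underS[OF N conjunct2[OF qf_fms_vars[OF t]]])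
  let ?f = "map_sum (h \<circ> Inl) (h \<circ> Inr)"
  define \<phi> where "\<phi> = map_fm ?f \<theta>"
  define c where "c i s = (if s \<in> underS (kap N) \<alpha>
    then Some (case_sum (u i) (v i) (inv_into ?W h s)) else None)" for i s
  have hW: "h w \<in> underS (kap N) \<alpha>" if "w \<in> ?W" for w using h that by (auto simp: bij_betw_def)
  have ch: "the (c i (h w)) = case_sum (u i) (v i) w" if "w \<in> ?W" for i w
    using h that hW by (simp add: c_def bij_betw_def)
  have phi: "\<phi> \<in> qf_fms N (underS (kap N) \<alpha> <+> underS (kap N) \<alpha>)"
    unfolding \<phi>_def
  proof (rule map_fm_in_qf_fms[OF t], rule image_subsetI)
    fix x assume "x \<in> ?W"
    then show "?f x \<in> underS (kap N) \<alpha> <+> underS (kap N) \<alpha>"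
      using hW[of x] by (cases x rule: sum.exhaust) auto
  qed
  have "sat N (case_sum (the \<circ> c i) (the \<circ> c j)) \<phi> \<longleftrightarrow> sat N (case_sum (u i) (v j)) \<theta>" for i j
    unfolding \<phi>_def sat_map
  proof (rule sat_cong)
    fix x assume "x \<in> ?W"
    then show "(case_sum (the \<circ> c i) (the \<circ> c j) \<circ> ?f) x = case_sum (u i) (v j) x"
      using ch[of x] by (cases x rule: sum.exhaust) auto
  qed
  moreover have "c i \<in> tuples N \<alpha> UNIV" for i by (auto simp: tuples_def c_def dom_def)
  ultimately show ?thesis
    unfolding order_property_def using a phi ord by (intro bexI[of _ \<alpha>] bexI[of _ \<phi>] exI[of _ c]) auto
qed

locale no_long_order =
  fixes N :: "('k, 'f, 'r, 'a) struc" and \<chi>\<^sub>0 :: "'c rel"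
  assumes structure_N: "infinitary_structure N"
    and Card_order_chi0: "Card_order \<chi>\<^sub>0"
    and lang_card_le: "lang_card N \<le>o \<chi>\<^sub>0"
    and no_order_property: "\<not> order_property N (cardSuc \<chi>\<^sub>0)"
begin

abbreviation exp2_chi0 :: "(('c \<Rightarrow> bool) \<Rightarrow> bool) rel" where
  "exp2_chi0 \<equiv> ctwo ^c (ctwo ^c \<chi>\<^sub>0)"

section \<open>Size of the language and number of formulas\<close>

lemma Cinfinite_kap: "Cinfinite (kap N)"
  using structure_N by (simp add: infinitary_structure_def cinfinite_def)

lemma Card_order_kap: "Card_order (kap N)"
  using Cinfinite_kap by blast

lemma Card_order_lang_card: "Card_order (lang_card N)"
  using is_sup_cexp_cexp_less[OF Card_order_csum Card_order_kap]
  by (auto simp: is_sup_cexp_def lang_card_def)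

lemma lang_exp_le:
  fixes \<theta> :: "'k rel"
  assumes "Card_order \<theta>" "\<theta> <o kap N"
  shows "(( |funs N| +c |rels N| ) +c ctwo) ^c \<theta> \<le>o \<chi>\<^sub>0"
proof -
  have "is_sup_cexp (( |funs N| +c |rels N| ) +c ctwo) (kap N) (lang_card N)"
    unfolding lang_card_def by (rule is_sup_cexp_cexp_less[OF Card_order_csum Card_order_kap])
  then have "(( |funs N| +c |rels N| ) +c ctwo) ^c \<theta> \<le>o lang_card N"
    using assms unfolding is_sup_cexp_def by blast
  then show ?thesis using lang_card_le by (rule ordLeq_transitive)
qed

text \<open>Otherwise \<open>\<chi>\<^sub>0\<close> is itself one of the exponents below \<kappa>,
  and its power of two would be at most \<open>lang_card N\<close> and hence at most
  \<open>\<chi>\<^sub>0\<close>, against Cantor.\<close>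

lemma kap_le: "kap N \<le>o \<chi>\<^sub>0"
proof (rule ccontr)
  have wo: "Well_order (kap N)" "Well_order \<chi>\<^sub>0"
    using Card_order_kap Card_order_chi0 card_order_on_well_order_on by blast+
  assume "\<not> kap N \<le>o \<chi>\<^sub>0"
  then have "\<chi>\<^sub>0 <o kap N" using wo not_ordLeq_iff_ordLess by blast
  from iffD1[OF internalize_ordLess this]
  obtain p :: "'k rel" where p: "\<chi>\<^sub>0 =o p" "p <o kap N" by blast
  have co: "Card_order p" using Card_order_ordIso2[OF Card_order_chi0 p(1)] .
  have "p <o ctwo ^c p" by (rule ordLess_ctwo_cexp[OF co])
  also have "ctwo ^c p \<le>o (( |funs N| +c |rels N| ) +c ctwo) ^c p"
    by (rule cexp_mono1[OF ordLeq_csum2[OF Card_order_ctwo] co])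
  also have "(( |funs N| +c |rels N| ) +c ctwo) ^c p \<le>o \<chi>\<^sub>0"
    by (rule lang_exp_le[OF co p(2)])
  also have "\<chi>\<^sub>0 =o p" by (rule p(1))
  finally show False using ordLess_irreflexive by blast
qed

lemma Cinfinite_chi0: "Cinfinite \<chi>\<^sub>0"
  using Cinfinite_ordLeq_trans[OF Cinfinite_kap kap_le Card_order_chi0] .

text \<open>The exponent 1 lies below \<kappa>, so the supremum defining \<open>lang_card N\<close>
  dominates its base.\<close>

lemma lang_le: "|funs N| +c |rels N| \<le>o \<chi>\<^sub>0"
proof -
  let ?t = "|{undefined :: 'k}|"
  have "|funs N| +c |rels N| \<le>o ( |funs N| +c |rels N| ) +c ctwo"
    by (rule ordLeq_csum1[OF Card_order_csum])
  also have "( |funs N| +c |rels N| ) +c ctwo \<le>o (( |funs N| +c |rels N| ) +c ctwo) ^c ?t"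
    by (rule ordLeq_cexp1[OF _ Card_order_csum])
      (simp add: card_of_Card_order card_of_ordIso_czero_iff_empty)
  also have "(( |funs N| +c |rels N| ) +c ctwo) ^c ?t \<le>o \<chi>\<^sub>0"
    by (rule lang_exp_le[OF card_of_Card_order finite_Cinfinite_bound[OF _ Cinfinite_kap]]) simp
  finally show ?thesis .
qed

lemma funs_le: "|funs N| \<le>o \<chi>\<^sub>0"
  using ordLeq_transitive[OF ordLeq_csum1[OF card_of_Card_order] lang_le] .

lemma rels_le: "|rels N| \<le>o \<chi>\<^sub>0"
  using ordLeq_transitive[OF ordLeq_csum2[OF card_of_Card_order] lang_le] .

lemma Cinfinite_exp_chi0: "Cinfinite (ctwo ^c \<chi>\<^sub>0)"
  by (rule Cinfinite_cexp[OF ordLeq_refl[OF Card_order_ctwo] Cinfinite_chi0])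

lemma Cinfinite_exp2_chi0: "Cinfinite exp2_chi0"
  by (rule Cinfinite_cexp[OF ordLeq_refl[OF Card_order_ctwo] Cinfinite_exp_chi0])

lemma chi0_le_exp: "\<chi>\<^sub>0 \<le>o ctwo ^c \<chi>\<^sub>0"
  by (rule ordLess_imp_ordLeq[OF ordLess_ctwo_cexp[OF Card_order_chi0]])

lemma chi0_le_exp2: "\<chi>\<^sub>0 \<le>o exp2_chi0"
  by (rule ordLeq_transitive[OF chi0_le_exp ordLess_imp_ordLeq[OF ordLess_ctwo_cexp[OF Card_order_cexp]]])

lemma Field_kap_le: "|Field (kap N)| \<le>o \<chi>\<^sub>0"
  by (rule ordIso_ordLeq_trans[OF card_of_Field_ordIso[OF Card_order_kap] kap_le])

lemma less_kap_le: "|W| <o kap N \<Longrightarrow> |W| \<le>o \<chi>\<^sub>0"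
  by (rule ordLeq_transitive[OF ordLess_imp_ordLeq kap_le])

text \<open>Term codes are subsets of a set of size at most \<open>\<chi>\<^sub>0\<close>, which
  gives the first exponential. They occur in the labels of formula codes, which are thus subsets of
  a set of size at most \<open>ctwo ^c \<chi>\<^sub>0\<close>; this gives the second.\<close>

lemma card_qf_fms_le:
  assumes V: "|V| \<le>o \<chi>\<^sub>0"
  shows "|qf_fms N V| \<le>o exp2_chi0"
proof -
  let ?K = "Field (kap N)"
  let ?L = "Pow (lists ?K \<times> (V <+> funs N))"
  let ?R = "lists (insert None (Some ` ?K)) \<times>
    ((?L \<times> ?L) <+> ((rels N \<times> Pow (?K \<times> lists ?K \<times> (V <+> funs N))) <+> (UNIV :: bool set)))"
  note inf = Cinfinite_chi0 and inf1 = Cinfinite_exp_chi0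
  have K: "|?K| \<le>o \<chi>\<^sub>0" by (rule Field_kap_le)
  have lK: "|lists ?K| \<le>o \<chi>\<^sub>0" by (rule card_lists_le[OF K inf])
  have VF: "|V <+> funs N| \<le>o \<chi>\<^sub>0" by (rule Plus_Cinfinite_bound[OF V funs_le inf])
  have lVF: "|lists ?K \<times> (V <+> funs N)| \<le>o \<chi>\<^sub>0"
    by (rule Times_Cinfinite_bound[OF lK VF inf])
  have L: "|?L| \<le>o ctwo ^c \<chi>\<^sub>0"
    by (rule card_Pow_le_cexp[OF lVF Card_order_chi0])
  have RL: "|Pow (?K \<times> lists ?K \<times> (V <+> funs N))| \<le>o ctwo ^c \<chi>\<^sub>0"
    by (rule card_Pow_le_cexp[OF Times_Cinfinite_bound[OF K lVF inf] Card_order_chi0])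
  have "|{None} \<union> Some ` ?K| \<le>o \<chi>\<^sub>0"
  proof (rule Un_Cinfinite_bound[OF _ _ inf])
    show "|{None}| \<le>o \<chi>\<^sub>0" by (rule ordLess_imp_ordLeq[OF finite_Cinfinite_bound[OF _ inf]]) simp
    show "|Some ` ?K| \<le>o \<chi>\<^sub>0" by (rule ordLeq_transitive[OF card_of_image K])
  qed
  from ordLeq_transitive[OF card_lists_le[OF this inf] chi0_le_exp]
  have "|lists (insert None (Some ` ?K))| \<le>o ctwo ^c \<chi>\<^sub>0" by simp
  moreover have "|rels N| \<le>o ctwo ^c \<chi>\<^sub>0" by (rule ordLeq_transitive[OF rels_le chi0_le_exp])
  moreover have "|UNIV :: bool set| \<le>o ctwo ^c \<chi>\<^sub>0"
    by (rule ordLess_imp_ordLeq[OF finite_Cinfinite_bound[OF _ inf1]]) simp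
  ultimately have R: "|?R| \<le>o ctwo ^c \<chi>\<^sub>0"
    using L RL by (intro Times_Cinfinite_bound Plus_Cinfinite_bound inf1)
  have "fm_code ` qf_fms N V \<subseteq> Pow ?R"
    using fm_code_subset[of N _ V] unfolding qf_fms_def by blast
  moreover have "inj_on fm_code (qf_fms N V)"
    using fm_code_inj by (auto simp: inj_on_def)
  ultimately have "|qf_fms N V| \<le>o |Pow ?R|" unfolding card_of_ordLeq[symmetric] by blast
  also have "|Pow ?R| \<le>o exp2_chi0" by (rule card_Pow_le_cexp[OF R Card_order_cexp])
  finally show ?thesis .
qed

end

section \<open>Nonsplitting\<close>

text \<open>Pigeonhole: at most \<open>r\<close> fibres of size at most \<open>r\<close> cover at
  most \<open>r\<close> points. The threshold \<open>c\<close> is separate because the fibres have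
  to exceed only \<open>\<chi>\<^sub>0\<close>, while the number of values is larger.\<close>

lemma large_fibre:
  assumes f: "f ` J \<subseteq> Y" and Y: "|Y| \<le>o r" and r: "Cinfinite r"
    and J: "\<not> |J| \<le>o r" and c: "c \<le>o r"
  obtains y where "y \<in> Y" "\<not> |{j \<in> J. f j = y}| \<le>o c"
proof -
  have "\<exists>y\<in>Y. \<not> |{j \<in> J. f j = y}| \<le>o c"
  proof (rule ccontr)
    assume "\<not> (\<exists>y\<in>Y. \<not> |{j \<in> J. f j = y}| \<le>o c)"
    then have "\<forall>y\<in>Y. |{j \<in> J. f j = y}| \<le>o r"
      using ordLeq_transitive[OF _ c] by blast
    then have "|\<Union>y\<in>Y. {j \<in> J. f j = y}| \<le>o r" by (rule UNION_Cinfinite_bound[OF Y _ r])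
    moreover have "(\<Union>y\<in>Y. {j \<in> J. f j = y}) = J" using f by auto
    ultimately show False using J by simp
  qed
  then show ?thesis using that by blast
qed

definition param_vars :: "('k, 'f, 'r, 'v + 'w) fm \<Rightarrow> 'w set" where
  "param_vars \<phi> = {s. Inr s \<in> fm_vars \<phi>}"

lemma param_vars_Neg [simp]: "param_vars (Neg \<phi>) = param_vars \<phi>"
  by (simp add: param_vars_def)

lemma card_param_vars: "\<phi> \<in> qf_fms N V \<Longrightarrow> |param_vars \<phi>| <o kap N"
proof -
  assume "\<phi> \<in> qf_fms N V"
  then have v: "|fm_vars \<phi>| <o kap N" by (simp add: qf_fms_def)
  have "inj_on Inr (param_vars \<phi>)" "Inr ` param_vars \<phi> \<subseteq> fm_vars \<phi>"
    by (auto simp: param_vars_def)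
  then have "|param_vars \<phi>| \<le>o |fm_vars \<phi>|" unfolding card_of_ordLeq[symmetric] by blast
  then show ?thesis using v by (rule ordLeq_ordLess_trans)
qed

context no_long_order
begin

definition pt :: 'k where "pt = the_elem (underS (kap N) (one_len N))"

text \<open>Distinct elements of \<kappa> have strictly nested initial segments, so at most one of
  these has a single element; this justifies the definite description in
  \<open>one_len\<close>.\<close>

lemma one_len_in: "one_len N \<in> Field (kap N)"
  and underS_one_len: "underS (kap N) (one_len N) = {pt}"
proof -
  have wo: "wo_rel (kap N)"
    using Card_order_kap card_order_on_well_order_on unfolding wo_rel_def by blast
  obtain \<alpha> and h :: "unit \<Rightarrow> 'k" where a: "\<alpha> \<in> Field (kap N)" and h: "bij_betw h UNIV (underS (kap N) \<alpha>)"
    by (rule card_less_bij_underS[OF Card_order_kap finite_Cinfinite_bound[OF finite_UNIV Cinfinite_kap]])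
  have card: "card (underS (kap N) \<alpha>) = 1" using bij_betw_same_card[OF h] by simp
  have less: False if "\<beta> \<in> Field (kap N)" "\<gamma> \<in> Field (kap N)" "card (underS (kap N) \<beta>) = 1"
    "card (underS (kap N) \<gamma>) = 1" "(\<beta>, \<gamma>) \<in> kap N" "\<beta> \<noteq> \<gamma>" for \<beta> \<gamma>
  proof -
    have fin: "finite (underS (kap N) \<gamma>)" using that(4) by (auto intro: card_ge_0_finite)
    have "underS (kap N) \<beta> \<subseteq> underS (kap N) \<gamma>"
      using wo_rel.TRANS[OF wo] wo_rel.ANTISYM[OF wo] that(5,6)
      unfolding underS_def trans_def antisym_def by blast
    moreover have "\<beta> \<in> underS (kap N) \<gamma>" "\<beta> \<notin> underS (kap N) \<beta>"
      using that unfolding underS_def by auto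
    ultimately have "underS (kap N) \<beta> \<subset> underS (kap N) \<gamma>" by blast
    from psubset_card_mono[OF fin this] show False using that(3,4) by simp
  qed
  have "\<exists>!\<alpha>. \<alpha> \<in> Field (kap N) \<and> card (underS (kap N) \<alpha>) = 1"
  proof (rule ex1I[of _ \<alpha>])
    fix \<beta> assume b: "\<beta> \<in> Field (kap N) \<and> card (underS (kap N) \<beta>) = 1"
    show "\<beta> = \<alpha>"
    proof (rule ccontr)
      assume "\<beta> \<noteq> \<alpha>"
      moreover have "(\<beta>, \<alpha>) \<in> kap N \<or> (\<alpha>, \<beta>) \<in> kap N"
        using wo_rel.TOTALS[OF wo] a b by blast
      ultimately show False using less[of \<beta> \<alpha>] less[of \<alpha> \<beta>] a b card by blast
    qed
  qed (use a card in blast)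
  from theI'[OF this]
  have one: "one_len N \<in> Field (kap N)" "card (underS (kap N) (one_len N)) = 1"
    unfolding one_len_def by blast+
  from one(2) obtain x where "underS (kap N) (one_len N) = {x}" by (rule card_1_singletonE)
  with one(1) show "one_len N \<in> Field (kap N)" "underS (kap N) (one_len N) = {pt}"
    unfolding pt_def by simp_all
qed

lemma tuples_one_len: "tuples N (one_len N) X = (\<lambda>a. [pt \<mapsto> a]) ` X"
proof (intro set_eqI iffI)
  fix c assume c: "c \<in> tuples N (one_len N) X"
  then have d: "dom c = {pt}" by (simp add: tuples_def underS_one_len)
  then obtain a where a: "c pt = Some a" by auto
  have "c = [pt \<mapsto> a]" using d a by (auto simp: fun_eq_iff dom_def)
  moreover have "a \<in> X" using c a ranI[of c pt a] unfolding tuples_def by blast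
  ultimately show "c \<in> (\<lambda>a. [pt \<mapsto> a]) ` X" by blast
qed (auto simp: tuples_def underS_one_len split: if_splits)

lemma tp_one_eq_iff: "tp N [pt \<mapsto> a] A = tp N [pt \<mapsto> c] A \<longleftrightarrow> same_type N A a c"
proof -
  have t: "[pt \<mapsto> x] \<in> tuples N (one_len N) UNIV" for x by (simp add: tuples_one_len)
  have "eqv N A {pt} (the \<circ> [pt \<mapsto> a]) (the \<circ> [pt \<mapsto> c]) \<longleftrightarrow> same_type N A a c" (is "?L \<longleftrightarrow> ?R")
  proof
    assume ?L then show ?R by (rule eqv_reindex) auto
  next
    assume ?R then show ?L by (rule eqv_reindex) auto
  qed
  then show ?thesis using tp_eq_iff_eqv[OF t t, where A = A] by (simp add: underS_one_len)
qed

abbreviation ev :: "'a \<Rightarrow> ('w \<Rightarrow> 'a) \<Rightarrow> ('k, 'f, 'r, 'v + 'w) fm \<Rightarrow> bool" where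
  "ev c b \<phi> \<equiv> sat N (case_sum (\<lambda>_. c) b) \<phi>"

abbreviation one_fms :: "('k, 'f, 'r, 'k + 'k) fm set" where
  "one_fms \<equiv> qf_fms N ({pt} <+> Field (kap N))"

text \<open>A semantic version of nonsplitting for the type of \<open>c\<close> over
  \<open>X\<close>, with families in place of tuples. Confining the parameters to \<open>X\<close>
  replaces membership of the instances in that type; one implication is enough because
  \<open>eqv\<close> is symmetric.\<close>

definition nonsplitting :: "'a \<Rightarrow> 'a set \<Rightarrow> 'a set \<Rightarrow> bool" where
  "nonsplitting c A X \<longleftrightarrow> (\<forall>\<phi>\<in>one_fms. \<forall>b b'.
     b ` param_vars \<phi> \<subseteq> X \<and> b' ` param_vars \<phi> \<subseteq> X \<and> eqv N A (param_vars \<phi>) b b' \<longrightarrow>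
     ev c b \<phi> \<longrightarrow> ev c b' \<phi>)"

lemma nonsplittingD:
  assumes "nonsplitting c A X" "\<phi> \<in> one_fms" "b ` param_vars \<phi> \<subseteq> X" "b' ` param_vars \<phi> \<subseteq> X"
    "eqv N A (param_vars \<phi>) b b'"
  shows "ev c b \<phi> \<longleftrightarrow> ev c b' \<phi>"
  using assms eqv_sym[OF assms(5)] unfolding nonsplitting_def by blast

lemma card_one_fms: "|one_fms| \<le>o exp2_chi0"
  by (intro card_qf_fms_le Plus_Cinfinite_bound Field_kap_le Cinfinite_chi0
      ordLess_imp_ordLeq[OF finite_Cinfinite_bound]) simp

lemma same_type_ev:
  assumes "same_type N X a c" "\<phi> \<in> qf_fms N V" "b ` param_vars \<phi> \<subseteq> X"
  shows "ev a b \<phi> \<longleftrightarrow> ev c b \<phi>"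
proof (rule eqv_sat[OF assms(1,2)])
  fix v assume "v \<in> fm_vars \<phi>"
  then show "(\<exists>w\<in>UNIV. case_sum (\<lambda>_. a) b v = a \<and> case_sum (\<lambda>_. c) b v = c) \<or>
      case_sum (\<lambda>_. a) b v = case_sum (\<lambda>_. c) b v \<and> case_sum (\<lambda>_. a) b v \<in> X"
    using assms(3) by (cases v rule: sum.exhaust) (auto simp: param_vars_def)
qed

lemma eqv_ev:
  assumes "eqv N X (param_vars \<phi>) b b'" "\<phi> \<in> qf_fms N V" "a \<in> X"
  shows "ev a b \<phi> \<longleftrightarrow> ev a b' \<phi>"
proof (rule eqv_sat[OF assms(1,2)])
  fix v assume "v \<in> fm_vars \<phi>"
  then show "(\<exists>w\<in>param_vars \<phi>. case_sum (\<lambda>_. a) b v = b w \<and> case_sum (\<lambda>_. a) b' v = b' w) \<or>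
      case_sum (\<lambda>_. a) b v = case_sum (\<lambda>_. a) b' v \<and> case_sum (\<lambda>_. a) b v \<in> X"
    using assms(3) by (cases v rule: sum.exhaust) (auto simp: param_vars_def)
qed

text \<open>Binary conjunction is \<open>Conj\<close> over the initial segment of \<kappa> with two
  elements.\<close>

lemma qf_fms_conj:
  assumes "\<phi> \<in> qf_fms N V" "\<psi> \<in> qf_fms N V"
  obtains \<theta> where "\<theta> \<in> qf_fms N V" "\<And>s. sat N s \<theta> \<longleftrightarrow> sat N s \<phi> \<and> sat N s \<psi>"
proof -
  obtain \<gamma> and h :: "bool \<Rightarrow> 'k" where g: "\<gamma> \<in> Field (kap N)" and h: "bij_betw h UNIV (underS (kap N) \<gamma>)"
    by (rule card_less_bij_underS[OF Card_order_kap finite_Cinfinite_bound[OF finite_UNIV Cinfinite_kap]])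
  have ne: "h True \<noteq> h False" and ran_h: "range h = underS (kap N) \<gamma>"
    using h by (auto simp: bij_betw_def inj_on_def)
  define \<phi>s where "\<phi>s s = (if s \<in> underS (kap N) \<gamma> then Some (if s = h True then \<phi> else \<psi>) else None)" for s
  have ran: "ran \<phi>s = {\<phi>, \<psi>}"
  proof
    show "ran \<phi>s \<subseteq> {\<phi>, \<psi>}" by (auto simp: ran_def \<phi>s_def split: if_splits)
    have "\<phi>s (h True) = Some \<phi>" "\<phi>s (h False) = Some \<psi>"
      using ran_h ne by (auto simp: \<phi>s_def)
    then show "{\<phi>, \<psi>} \<subseteq> ran \<phi>s" by (auto intro: ranI)
  qed
  have dom: "dom \<phi>s = underS (kap N) \<gamma>" by (auto simp: \<phi>s_def dom_def)
  have vars: "fm_vars (Conj \<phi>s) = fm_vars \<phi> \<union> fm_vars \<psi>"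
  proof -
    have "fm_vars (Conj \<phi>s) = (\<Union>\<phi>\<in>ran \<phi>s. fm_vars \<phi>)"
      by (auto simp: ran_def)
    then show ?thesis using ran by simp
  qed
  have "|fm_vars \<phi> \<union> fm_vars \<psi>| <o kap N"
    by (rule card_of_Un_ordLess_infinite_Field)
      (use assms Cinfinite_kap in \<open>auto simp: qf_fms_def cinfinite_def\<close>)
  then have "Conj \<phi>s \<in> qf_fms N V"
    using assms ran dom g by (auto simp: qf_fms_def vars simp del: fm.set intro!: wf_fm.intros)
  moreover have "sat N s (Conj \<phi>s) \<longleftrightarrow> sat N s \<phi> \<and> sat N s \<psi>" for s
    unfolding sat_Conj ran by simp
  ultimately show ?thesis by (rule that)
qed

section \<open>A small base for each formula\<close>

lemma cardSuc_chi0_wo: "wo_rel (cardSuc \<chi>\<^sub>0)"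
  unfolding wo_rel_def by (rule cardSuc_Well_order[OF Card_order_chi0])

lemma card_underS_cardSuc: "|underS (cardSuc \<chi>\<^sub>0) i| \<le>o \<chi>\<^sub>0"
proof (cases "i \<in> Field (cardSuc \<chi>\<^sub>0)")
  case True
  then have "|underS (cardSuc \<chi>\<^sub>0) i| <o cardSuc \<chi>\<^sub>0"
    by (rule card_of_underS[OF cardSuc_Card_order[OF Card_order_chi0]])
  then show ?thesis
    using cardSuc_ordLeq_ordLess[OF Card_order_chi0 card_of_Card_order] by blast
next
  case False
  then have "underS (cardSuc \<chi>\<^sub>0) i = {}" by (rule underS_empty)
  then show ?thesis by (simp add: ordLess_imp_ordLeq[OF finite_Cinfinite_bound[OF finite.emptyI Cinfinite_chi0]])
qed

lemma cardSuc_le_exp2: "cardSuc \<chi>\<^sub>0 \<le>o exp2_chi0"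
proof -
  have "\<chi>\<^sub>0 <o exp2_chi0"
    by (rule ordLess_transitive[OF ordLess_ctwo_cexp[OF Card_order_chi0] ordLess_ctwo_cexp[OF Card_order_cexp]])
  then show ?thesis using cardSuc_ordLess_ordLeq[OF Card_order_chi0 Card_order_cexp] by blast
qed

text \<open>If no small base exists, choose triples of \<open>a i\<close>, \<open>b i\<close>,
  \<open>b' i\<close> by recursion along \<open>cardSuc \<chi>\<^sub>0\<close>: \<open>b i\<close>
  and \<open>b' i\<close> have the same type over all earlier choices but are separated by
  \<open>\<phi>\<close> at \<open>c\<close>, and \<open>a i\<close> agrees with \<open>c\<close>
  over the earlier choices and over \<open>b i\<close> and \<open>b' i\<close>. Then
  \<open>a i\<close> separates \<open>b j\<close> from \<open>b' j\<close> exactly when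
  \<open>j\<close> is not later than \<open>i\<close>, a long order.\<close>

lemma small_base_for_formula:
  fixes \<phi> :: "('k, 'f, 'r, 'v + 'w) fm"
  assumes real: "\<And>X. X \<subseteq> P \<Longrightarrow> |X| \<le>o \<chi>\<^sub>0 \<Longrightarrow> \<exists>a\<in>P. same_type N X a c"
    and phi: "\<phi> \<in> qf_fms N V"
  shows "\<exists>A\<subseteq>P. |A| \<le>o \<chi>\<^sub>0 \<and> (\<forall>b b'. b ` param_vars \<phi> \<subseteq> P \<and> b' ` param_vars \<phi> \<subseteq> P \<and>
    eqv N A (param_vars \<phi>) b b' \<longrightarrow> ev c b \<phi> \<longrightarrow> ev c b' \<phi>)"
proof (rule ccontr)
  assume neg: "\<not> ?thesis"
  let ?W = "param_vars \<phi>"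
  let ?r = "cardSuc \<chi>\<^sub>0"
  define st where "st t = insert (fst t) (fst (snd t) ` ?W \<union> snd (snd t) ` ?W)" for t :: "'a \<times> ('w \<Rightarrow> 'a) \<times> ('w \<Rightarrow> 'a)"
  have W: "|?W| \<le>o \<chi>\<^sub>0" by (rule less_kap_le[OF card_param_vars[OF phi]])
  have imW: "|b ` ?W| \<le>o \<chi>\<^sub>0" for b :: "'w \<Rightarrow> 'a" by (rule ordLeq_transitive[OF card_of_image W])
  note Un = Un_Cinfinite_bound[OF _ _ Cinfinite_chi0]
  have card_st: "|st t| \<le>o \<chi>\<^sub>0" for t
  proof -
    have "|{fst t} \<union> (fst (snd t) ` ?W \<union> snd (snd t) ` ?W)| \<le>o \<chi>\<^sub>0"
      by (rule Un[OF ordLess_imp_ordLeq[OF finite_Cinfinite_bound[OF _ Cinfinite_chi0]] Un[OF imW imW]]) simp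
    then show ?thesis by (simp add: st_def)
  qed
  define base where "base f i = (\<Union>j\<in>underS ?r i. st (f j))" for f i
  have card_base: "|base f i| \<le>o \<chi>\<^sub>0" for f i
    unfolding base_def
    by (rule UNION_Cinfinite_bound[OF card_underS_cardSuc _ Cinfinite_chi0]) (rule ballI, rule card_st)
  define good where "good f i t \<longleftrightarrow> st t \<subseteq> P \<and> eqv N (base f i) ?W (fst (snd t)) (snd (snd t)) \<and>
      ev c (fst (snd t)) \<phi> \<and> \<not> ev c (snd (snd t)) \<phi> \<and>
      same_type N (base f i \<union> (fst (snd t) ` ?W \<union> snd (snd t) ` ?W)) (fst t) c" for f i t
  have step: "\<exists>t. good f i t" if sub: "base f i \<subseteq> P" for f i
  proof -
    obtain b b' where b: "b ` ?W \<subseteq> P" "b' ` ?W \<subseteq> P" "eqv N (base f i) ?W b b'" "ev c b \<phi>" "\<not> ev c b' \<phi>"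
      using neg[simplified, rule_format, OF card_base[of f i] sub] by blast
    let ?X = "base f i \<union> (b ` ?W \<union> b' ` ?W)"
    have "|?X| \<le>o \<chi>\<^sub>0" by (rule Un[OF card_base Un[OF imW imW]])
    moreover have "?X \<subseteq> P" using sub b(1,2) by blast
    ultimately obtain a where a: "a \<in> P" "same_type N ?X a c" using real[of ?X] by blast
    then have "good f i (a, b, b')" using a(1) b unfolding good_def st_def by simp
    then show ?thesis ..
  qed
  have "\<exists>f. \<forall>i. good f i (f i)"
  \<comment> \<open>\<open>good f i\<close> reads \<open>f\<close> only strictly below
    \<open>i\<close>, and the earlier choices being good keeps \<open>base f i\<close> inside
    \<open>P\<close>; this is what the recursion needs.\<close>
  proof (rule dependent_wf_choice[of "?r - Id"])
    show "wf (?r - Id)" using wo_rel.WF[OF cardSuc_chi0_wo] .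
    show "good f i t = good g i t" if "\<And>z. (z, i) \<in> ?r - Id \<Longrightarrow> f z = g z" for f g i t
    proof -
      have "base f i = base g i" using that by (auto simp: base_def underS_def)
      then show ?thesis by (simp add: good_def)
    qed
    show "\<exists>t. good f i t" if "\<And>j. (j, i) \<in> ?r - Id \<Longrightarrow> good f j (f j)" for f i
      by (rule step) (use that in \<open>auto simp: base_def underS_def good_def\<close>)
  qed
  then obtain f where f: "\<And>i. good f i (f i)" by blast
  define a where "a i = fst (f i)" for i
  define b where "b i = fst (snd (f i))" for i
  define b' where "b' i = snd (snd (f i))" for i
  have e: "eqv N (base f i) ?W (b i) (b' i)" and t: "ev c (b i) \<phi>" "\<not> ev c (b' i) \<phi>" for i
    using f[of i] by (simp_all add: good_def b_def b'_def)
  have s: "same_type N (base f i \<union> (b i ` ?W \<union> b' i ` ?W)) (a i) c" for i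
    using f[of i] by (simp add: good_def a_def b_def b'_def)
  have in_base: "a i \<in> base f j" "b i ` ?W \<subseteq> base f j" "b' i ` ?W \<subseteq> base f j"
    if "(i, j) \<in> ?r" "i \<noteq> j" for i j
    using that unfolding base_def underS_def st_def a_def b_def b'_def by blast+
  \<comment> \<open>The two parameter families receive disjoint copies of the variables, so that a
    single formula can state that \<open>\<phi>\<close> separates them.\<close>
  define \<phi>\<^sub>1 :: "('k, 'f, 'r, 'v + ('w + 'w)) fm" where "\<phi>\<^sub>1 = map_fm (map_sum id Inl) \<phi>"
  define \<phi>\<^sub>2 :: "('k, 'f, 'r, 'v + ('w + 'w)) fm" where "\<phi>\<^sub>2 = map_fm (map_sum id Inr) \<phi>"
  have "\<phi>\<^sub>1 \<in> qf_fms N UNIV" "Neg \<phi>\<^sub>2 \<in> qf_fms N UNIV"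
    unfolding \<phi>\<^sub>1_def \<phi>\<^sub>2_def by (intro Neg_in_qf_fms map_fm_in_qf_fms[OF phi] subset_UNIV)+
  then obtain \<theta> where th: "\<theta> \<in> qf_fms N UNIV" "\<And>s. sat N s \<theta> \<longleftrightarrow> sat N s \<phi>\<^sub>1 \<and> sat N s (Neg \<phi>\<^sub>2)"
    by (rule qf_fms_conj) blast
  have comp: "case_sum (\<lambda>_. a i) (case_sum (b j) (b' j)) \<circ> map_sum id Inl = case_sum (\<lambda>_. a i) (b j)"
    "case_sum (\<lambda>_. a i) (case_sum (b j) (b' j)) \<circ> map_sum id Inr = case_sum (\<lambda>_. a i) (b' j)" for i j
    by (auto simp: fun_eq_iff split: sum.splits)
  have "order_property N ?r"
  \<comment> \<open>\<open>\<theta>\<close> holds when \<open>j\<close> is not later than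
    \<open>i\<close>; the order property wants the strict relation of \<open>i\<close> before
    \<open>j\<close>, hence the negation.\<close>
  proof (rule order_propertyI[OF Card_order_kap Neg_in_qf_fms[OF th(1)]])
    fix i j assume ij: "i \<in> Field ?r" "j \<in> Field ?r"
    have eq: "sat N (case_sum (\<lambda>_. a i) (case_sum (b j) (b' j))) (Neg \<theta>) \<longleftrightarrow>
        \<not> (ev (a i) (b j) \<phi> \<and> \<not> ev (a i) (b' j) \<phi>)"
      by (simp only: sat.simps th(2) \<phi>\<^sub>1_def \<phi>\<^sub>2_def sat_map comp)
    show "sat N (case_sum (\<lambda>_. a i) (case_sum (b j) (b' j))) (Neg \<theta>) \<longleftrightarrow> (i, j) \<in> ?r \<and> i \<noteq> j"
    proof (cases "(i, j) \<in> ?r \<and> i \<noteq> j")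
      case True
      then have "ev (a i) (b j) \<phi> \<longleftrightarrow> ev (a i) (b' j) \<phi>"
        using eqv_ev[OF e phi] in_base(1) by blast
      then show ?thesis using True eq by blast
    next
      case False
      then have "(j, i) \<in> ?r" using wo_rel.TOTALS[OF cardSuc_chi0_wo] ij by blast
      then have "b j ` ?W \<subseteq> base f i \<union> (b i ` ?W \<union> b' i ` ?W)"
        "b' j ` ?W \<subseteq> base f i \<union> (b i ` ?W \<union> b' i ` ?W)"
        using in_base(2,3)[of j i] by blast+
      from this[THEN same_type_ev[OF s phi]] show ?thesis using t eq False by blast
    qed
  qed
  then show False using no_order_property by contradiction
qed

end

section \<open>Realizing chains\<close>

lemma saturated_mono: "saturated N \<mu> P \<Longrightarrow> \<mu>' \<le>o \<mu> \<Longrightarrow> saturated N \<mu>' P"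
  unfolding saturated_def saturated_len_def by (meson ordLess_ordLeq_trans)

context no_long_order
begin

text \<open>The union of the bases of the single formulas is a base for all of them. The bound rises
  from \<open>\<chi>\<^sub>0\<close> to \<open>exp2_chi0\<close> because there may be that many
  formulas.\<close>

lemma small_base:
  assumes real: "\<And>X. X \<subseteq> P \<Longrightarrow> |X| \<le>o \<chi>\<^sub>0 \<Longrightarrow> \<exists>a\<in>P. same_type N X a c"
  obtains A where "A \<subseteq> P" "|A| \<le>o exp2_chi0" "nonsplitting c A P"
proof -
  have "\<forall>\<phi>\<in>one_fms. \<exists>A\<subseteq>P. |A| \<le>o \<chi>\<^sub>0 \<and> (\<forall>b b'. b ` param_vars \<phi> \<subseteq> P \<and> b' ` param_vars \<phi> \<subseteq> P \<and>
    eqv N A (param_vars \<phi>) b b' \<longrightarrow> ev c b \<phi> \<longrightarrow> ev c b' \<phi>)"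
    by (rule ballI, rule small_base_for_formula[OF real])
  from bchoice[OF this] obtain D where D: "\<forall>\<phi>\<in>one_fms. D \<phi> \<subseteq> P \<and> |D \<phi>| \<le>o \<chi>\<^sub>0 \<and>
    (\<forall>b b'. b ` param_vars \<phi> \<subseteq> P \<and> b' ` param_vars \<phi> \<subseteq> P \<and>
    eqv N (D \<phi>) (param_vars \<phi>) b b' \<longrightarrow> ev c b \<phi> \<longrightarrow> ev c b' \<phi>)" by blast
  show ?thesis
  proof (rule that[of "\<Union>\<phi>\<in>one_fms. D \<phi>"])
    show "(\<Union>\<phi>\<in>one_fms. D \<phi>) \<subseteq> P" using D by blast
    have "\<forall>\<phi>\<in>one_fms. |D \<phi>| \<le>o exp2_chi0"
      using D ordLeq_transitive[OF _ chi0_le_exp2] by blast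
    then show "|\<Union>\<phi>\<in>one_fms. D \<phi>| \<le>o exp2_chi0"
      by (rule UNION_Cinfinite_bound[OF card_one_fms _ Cinfinite_exp2_chi0])
    show "nonsplitting c (\<Union>\<phi>\<in>one_fms. D \<phi>) P"
      unfolding nonsplitting_def
    proof (intro ballI allI impI, elim conjE)
      fix \<phi> and b b' :: "'k \<Rightarrow> 'a"
      assume phi: "\<phi> \<in> one_fms" and b: "b ` param_vars \<phi> \<subseteq> P" "b' ` param_vars \<phi> \<subseteq> P"
        and e: "eqv N (\<Union>\<phi>\<in>one_fms. D \<phi>) (param_vars \<phi>) b b'" and t: "ev c b \<phi>"
      have "eqv N (D \<phi>) (param_vars \<phi>) b b'" by (rule eqv_mono[OF e]) (use phi in auto)
      then show "ev c b' \<phi>" using D[rule_format, OF phi] b t by blast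
    qed
  qed
qed

lemma nonsplitting_base_mono:
  assumes "nonsplitting c A X" "A \<subseteq> A'"
  shows "nonsplitting c A' X"
  unfolding nonsplitting_def
proof (intro ballI allI impI, elim conjE)
  fix \<phi> and b b' :: "'k \<Rightarrow> 'a"
  assume "\<phi> \<in> one_fms" "b ` param_vars \<phi> \<subseteq> X" "b' ` param_vars \<phi> \<subseteq> X"
    and e: "eqv N A' (param_vars \<phi>) b b'" and "ev c b \<phi>"
  then show "ev c b' \<phi>"
    using nonsplittingD[OF assms(1) _ _ _ eqv_mono[OF e assms(2) order_refl]] by blast
qed

lemma chi_eq: "chi \<chi>\<^sub>0 = cardSuc exp2_chi0"
  by (simp add: chi_def)

lemma Card_order_chi: "Card_order (chi \<chi>\<^sub>0)"
  unfolding chi_eq by (rule cardSuc_Card_order[OF Card_order_cexp])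

lemma Cinfinite_chi: "Cinfinite (chi \<chi>\<^sub>0)"
  unfolding chi_eq by (rule Cinfinite_cardSuc[OF Cinfinite_exp2_chi0])

lemma less_chi_iff: "|X| <o chi \<chi>\<^sub>0 \<longleftrightarrow> |X| \<le>o exp2_chi0"
  unfolding chi_eq by (rule cardSuc_ordLeq_ordLess[OF Card_order_cexp card_of_Card_order])

text \<open>The clauses compare arbitrary indices instead of an index with its successor, so they
  pass to subsequences. One notion thus serves for the chain of length \<lambda> and for its
  subchain of length \<open>chi \<chi>\<^sub>0\<close>.\<close>

definition realizing_chain :: "'i rel \<Rightarrow> ('i \<Rightarrow> 'a set) \<Rightarrow> ('i \<Rightarrow> 'a) \<Rightarrow> 'a \<Rightarrow> bool" where
  "realizing_chain r P a c \<longleftrightarrow> Well_order r \<and> (\<forall>i j. (i, j) \<in> r \<longrightarrow> P i \<subseteq> P j) \<and>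
     (\<forall>i j. (i, j) \<in> r \<and> i \<noteq> j \<longrightarrow> a i \<in> P j) \<and>
     (\<forall>i\<in>Field r. same_type N (P i) (a i) c \<and> saturated N (cardSuc (chi \<chi>\<^sub>0)) (P i))"

lemma realizing_chainD:
  assumes "realizing_chain r P a c"
  shows "Well_order r" "\<And>i j. (i, j) \<in> r \<Longrightarrow> P i \<subseteq> P j" "\<And>i j. (i, j) \<in> r \<Longrightarrow> i \<noteq> j \<Longrightarrow> a i \<in> P j"
    "\<And>i. i \<in> Field r \<Longrightarrow> same_type N (P i) (a i) c"
    "\<And>i. i \<in> Field r \<Longrightarrow> saturated N (cardSuc (chi \<chi>\<^sub>0)) (P i)"
  using assms unfolding realizing_chain_def by auto

lemma saturated_cardSuc_chi_eqv:
  fixes b :: "'w \<Rightarrow> 'a"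
  assumes "saturated N (cardSuc (chi \<chi>\<^sub>0)) P" "X \<subseteq> P" "|X| \<le>o exp2_chi0" "|W| <o kap N"
  obtains b' where "eqv N X W b b'" "b' ` W \<subseteq> P"
proof -
  have "|X| <o chi \<chi>\<^sub>0" using assms(3) less_chi_iff by blast
  then have "|X| <o cardSuc (chi \<chi>\<^sub>0)"
    by (rule ordLess_transitive[OF _ cardSuc_greater[OF Card_order_chi]])
  from saturated_eqv[OF Card_order_kap assms(1,2) this assms(4)] that show ?thesis by metis
qed

text \<open>
  The parameters \<open>b\<^sub>j\<close> copying \<open>b\<close> over the earlier part of the sequence satisfy the formula with
  \<open>a\<^sub>i\<close> exactly when \<open>i < j\<close>: for \<open>j \<le> i\<close> they lie in \<open>P\<^sub>i\<close>, where \<open>a\<^sub>i\<close> agrees with \<open>c\<close>.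
\<close>
lemma few_exceptions:
  fixes b :: "'k \<Rightarrow> 'a"
  assumes chain: "realizing_chain r P a c" and l: "l \<in> Field r"
    and A: "A \<subseteq> P l" "|A| \<le>o exp2_chi0" and ns: "nonsplitting c A M"
    and PM: "\<And>i. i \<in> Field r \<Longrightarrow> P i \<subseteq> M"
    and phi: "\<phi> \<in> one_fms" and b: "b ` param_vars \<phi> \<subseteq> M"
  shows "|{j \<in> Field r. (l, j) \<in> r \<and> ev (a j) b \<phi> \<noteq> ev c b \<phi>}| \<le>o \<chi>\<^sub>0" (is "|?J| \<le>o _")
proof (rule ccontr)
  note ch = realizing_chainD[OF chain]
  let ?s = "cardSuc \<chi>\<^sub>0"
  assume "\<not> |?J| \<le>o \<chi>\<^sub>0"
  then obtain \<epsilon> where eJ: "\<And>i. i \<in> Field ?s \<Longrightarrow> \<epsilon> i \<in> ?J"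
    and mono: "\<And>i j. (i, j) \<in> ?s \<Longrightarrow> i \<noteq> j \<Longrightarrow> (\<epsilon> i, \<epsilon> j) \<in> r \<and> \<epsilon> i \<noteq> \<epsilon> j"
    by (rule large_subset_cardSuc_embedding[OF Card_order_chi0 ch(1), of ?J, rotated]) blast+
  \<comment> \<open>Copying over \<open>A\<close> preserves the value of \<open>\<phi>\<close> at
    \<open>c\<close>, by nonsplitting; copying over the earlier elements of the sequence preserves
    its value at each of them.\<close>
  define X where "X j = A \<union> (\<lambda>i. a (\<epsilon> i)) ` underS ?s j" for j
  have XP: "X j \<subseteq> P (\<epsilon> j)" if "j \<in> Field ?s" for j
    using A(1) ch(2)[of l "\<epsilon> j"] eJ[OF that] mono ch(3) unfolding X_def underS_def by blast
  have X_card: "|X j| \<le>o exp2_chi0" for j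
    unfolding X_def
    by (rule Un_Cinfinite_bound[OF A(2) ordLeq_transitive[OF card_of_image
        ordLeq_transitive[OF card_underS_cardSuc chi0_le_exp2]] Cinfinite_exp2_chi0])
  have "\<forall>j\<in>Field ?s. \<exists>b'. eqv N (X j) (param_vars \<phi>) b b' \<and> b' ` param_vars \<phi> \<subseteq> P (\<epsilon> j)"
  proof
    fix j assume j: "j \<in> Field ?s"
    have "saturated N (cardSuc (chi \<chi>\<^sub>0)) (P (\<epsilon> j))" using ch(5) eJ[OF j] by blast
    from saturated_cardSuc_chi_eqv[OF this XP[OF j] X_card card_param_vars[OF phi], of b]
    show "\<exists>b'. eqv N (X j) (param_vars \<phi>) b b' \<and> b' ` param_vars \<phi> \<subseteq> P (\<epsilon> j)" by blast
  qed
  from bchoice[OF this] obtain B where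
    B: "\<And>j. j \<in> Field ?s \<Longrightarrow> eqv N (X j) (param_vars \<phi>) b (B j) \<and> B j ` param_vars \<phi> \<subseteq> P (\<epsilon> j)" by blast
  have cB: "ev c (B j) \<phi> \<longleftrightarrow> ev c b \<phi>" if j: "j \<in> Field ?s" for j
  proof (rule nonsplittingD[OF ns phi _ b])
    show "B j ` param_vars \<phi> \<subseteq> M" using B[OF j] PM eJ[OF j] by blast
    show "eqv N A (param_vars \<phi>) (B j) b"
      by (rule eqv_sym[OF eqv_mono[OF conjunct1[OF B[OF j]]]]) (auto simp: X_def)
  qed
  \<comment> \<open>\<open>\<theta>\<close> expresses that \<open>\<phi>\<close> takes the value
    opposite to the one it has at \<open>c\<close> and \<open>b\<close>, which covers both kinds of
    exception.\<close>
  define \<theta> where "\<theta> = (if ev c b \<phi> then Neg \<phi> else \<phi>)"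
  have "order_property N ?s"
  proof (rule order_propertyI[OF Card_order_kap])
    show "\<theta> \<in> qf_fms N ({pt} <+> Field (kap N))" using phi by (simp add: \<theta>_def Neg_in_qf_fms)
    fix i j assume ij: "i \<in> Field ?s" "j \<in> Field ?s"
    have theta: "ev x y \<theta> \<longleftrightarrow> ev x y \<phi> \<noteq> ev c b \<phi>" for x and y :: "'k \<Rightarrow> 'a"
      by (simp add: \<theta>_def)
    show "ev (a (\<epsilon> i)) (B j) \<theta> \<longleftrightarrow> (i, j) \<in> ?s \<and> i \<noteq> j"
    proof (cases "(i, j) \<in> ?s \<and> i \<noteq> j")
      case True
      then have "a (\<epsilon> i) \<in> X j" by (auto simp: X_def underS_def)
      then have "ev (a (\<epsilon> i)) b \<phi> \<longleftrightarrow> ev (a (\<epsilon> i)) (B j) \<phi>"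
        using eqv_ev[OF _ phi] B[OF ij(2)] by blast
      then show ?thesis using True theta eJ[OF ij(1)] by blast
    next
      case False
      then have "(j, i) \<in> ?s" using wo_rel.TOTALS[OF cardSuc_chi0_wo] ij by blast
      then have "(\<epsilon> j, \<epsilon> i) \<in> r \<or> \<epsilon> j = \<epsilon> i" using mono by blast
      then have "P (\<epsilon> j) \<subseteq> P (\<epsilon> i)" by (elim disjE) (auto dest: ch(2))
      then have "B j ` param_vars \<phi> \<subseteq> P (\<epsilon> i)" using B[OF ij(2)] by blast
      then have "ev (a (\<epsilon> i)) (B j) \<phi> \<longleftrightarrow> ev c (B j) \<phi>"
        using same_type_ev[OF ch(4) phi] eJ[OF ij(1)] by blast
      then show ?thesis using False theta cB[OF ij(2)] by blast
    qed
  qed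
  then show False using no_order_property by contradiction
qed

text \<open>
  If the conclusion fails, then by counting formulas one formula \<open>\<psi>(x, y, z)\<close> and parameters
  \<open>d\<^sub>j\<close> in \<open>P\<^sub>l\<close> witness this for many \<open>j\<close>: \<open>\<psi>(a\<^sub>j, d\<^sub>j, b)\<close> holds, although the type of \<open>d\<^sub>j b\<close> over \<open>A\<close>
  is one for which the nonsplitting type of \<open>c\<close> contains \<open>\<not> \<psi>\<close>. As in \<open>few_exceptions\<close>, copies of \<open>b\<close>
  then produce a long order.
\<close>
lemma exists_nonsplitting:
  fixes b :: "'k \<Rightarrow> 'a"
  assumes chain: "realizing_chain r P a c" and l: "l \<in> Field r"
    and A: "A \<subseteq> P l" "|A| \<le>o exp2_chi0" and ns: "nonsplitting c A (\<Union>i\<in>Field r. P i)"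
    and W: "|W| <o kap N"
    and large: "\<not> |{j \<in> Field r. (l, j) \<in> r}| \<le>o exp2_chi0"
  shows "\<exists>j\<in>Field r. (l, j) \<in> r \<and> nonsplitting (a j) A (P l \<union> b ` W)"
proof (rule ccontr)
  note ch = realizing_chainD[OF chain]
  let ?s = "cardSuc \<chi>\<^sub>0"
  let ?J = "{j \<in> Field r. (l, j) \<in> r}"
  assume "\<not> ?thesis"
  then have bad: "\<not> nonsplitting (a j) A (P l \<union> b ` W)" if "j \<in> ?J" for j
    using that by blast
  have "\<forall>j\<in>?J. \<exists>t. fst t \<in> one_fms \<and> fst (snd t) ` param_vars (fst t) \<subseteq> P l \<union> b ` W \<and>
      snd (snd t) ` param_vars (fst t) \<subseteq> P l \<and>
      eqv N A (param_vars (fst t)) (fst (snd t)) (snd (snd t)) \<and>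
      ev (a j) (fst (snd t)) (fst t) \<and> \<not> ev c (snd (snd t)) (fst t)" (is "\<forall>j\<in>_. \<exists>t. ?Q j t")
  proof
    fix j assume "j \<in> ?J"
    then obtain \<phi> and e e' :: "'k \<Rightarrow> 'a" where phi: "\<phi> \<in> one_fms"
      and e: "e ` param_vars \<phi> \<subseteq> P l \<union> b ` W" "e' ` param_vars \<phi> \<subseteq> P l \<union> b ` W"
        "eqv N A (param_vars \<phi>) e e'" "ev (a j) e \<phi>" "\<not> ev (a j) e' \<phi>"
      using bad unfolding nonsplitting_def by blast
    \<comment> \<open>Since \<open>e\<close>, \<open>e'\<close> and \<open>g\<close> have one type
      over \<open>A\<close>, a single value of \<open>\<phi>\<close> at \<open>c\<close> and
      \<open>g\<close> is compared with the two different values at \<open>a j\<close>. It disagrees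
      with one of them, and that one provides the witness, with \<open>\<phi>\<close> negated if it
      is the value at \<open>e'\<close>.\<close>
    obtain g where g: "eqv N A (param_vars \<phi>) e g" "g ` param_vars \<phi> \<subseteq> P l"
      by (rule saturated_cardSuc_chi_eqv[OF ch(5)[OF l] A card_param_vars[OF phi]])
    show "\<exists>t. ?Q j t"
    proof (cases "ev c g \<phi>")
      case True
      have "eqv N A (param_vars \<phi>) e' g" using eqv_trans[OF eqv_sym[OF e(3)] g(1)] .
      then have "?Q j (Neg \<phi>, e', g)" using phi e g True Neg_in_qf_fms[OF phi] by simp
      then show ?thesis ..
    next
      case False
      then have "?Q j (\<phi>, e, g)" using phi e g by simp
      then show ?thesis ..
    qed
  qed
  from bchoice[OF this] obtain T where T: "\<forall>j\<in>?J. ?Q j (T j)" by blast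
  define F where "F j = fst (T j)" for j
  define e where "e j = fst (snd (T j))" for j
  define g where "g j = snd (snd (T j))" for j
  have Q: "F j \<in> one_fms" "e j ` param_vars (F j) \<subseteq> P l \<union> b ` W" "g j ` param_vars (F j) \<subseteq> P l"
    "eqv N A (param_vars (F j)) (e j) (g j)" "ev (a j) (e j) (F j)" "\<not> ev c (g j) (F j)"
    if "j \<in> ?J" for j
    using bspec[OF T that] unfolding F_def e_def g_def by blast+
  define w where "w y = inv_into W b y" for y
  have w: "w y \<in> W" "b (w y) = y" if "y \<in> b ` W" for y
    using that unfolding w_def by (simp_all add: inv_into_into f_inv_into_f)
  \<comment> \<open>Parameters in \<open>P l\<close> move to the left block, those from
    \<open>b\<close> become right variables indexed by \<open>W\<close>. The set of available
    variables no longer depends on \<open>j\<close> and has size at most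
    \<open>\<chi>\<^sub>0\<close>, so the formulas can be counted.\<close>
  define h :: "_ \<Rightarrow> 'k + 'k \<Rightarrow> ('k + 'k) + 'k" where
    "h j = case_sum (\<lambda>x. Inl (Inl x)) (\<lambda>s. if e j s \<in> P l then Inl (Inr s) else Inr (w (e j s)))" for j
  define \<psi> where "\<psi> j = map_fm (h j) (F j)" for j
  let ?Y = "qf_fms N (({pt} <+> Field (kap N)) <+> W)"
  have F_vars: "x = pt" if "j \<in> ?J" "Inl x \<in> fm_vars (F j)" for j x
    using qf_fms_vars[OF Q(1)[OF that(1)]] that(2) by blast
  have F_vars': "s \<in> Field (kap N)" if "j \<in> ?J" "Inr s \<in> fm_vars (F j)" for j s
    using qf_fms_vars[OF Q(1)[OF that(1)]] that(2) by blast
  have outside: "e j s \<in> b ` W" if "j \<in> ?J" "Inr s \<in> fm_vars (F j)" "e j s \<notin> P l" for j s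
    using Q(2)[OF that(1)] that(2,3) unfolding param_vars_def by blast
  have psi: "\<psi> j \<in> ?Y" if j: "j \<in> ?J" for j
    unfolding \<psi>_def
  proof (rule map_fm_in_qf_fms[OF Q(1)[OF j]], rule image_subsetI)
    fix v assume "v \<in> fm_vars (F j)"
    then show "h j v \<in> ({pt} <+> Field (kap N)) <+> W"
      using F_vars[OF j] F_vars'[OF j] outside[OF j] w(1)
      by (cases v rule: sum.exhaust) (auto simp: h_def)
  qed
  have "|({pt} <+> Field (kap N)) <+> W| \<le>o \<chi>\<^sub>0"
    by (intro Plus_Cinfinite_bound Field_kap_le Cinfinite_chi0 less_kap_le[OF W]
        ordLess_imp_ordLeq[OF finite_Cinfinite_bound]) simp
  then have Y: "|?Y| \<le>o exp2_chi0" by (rule card_qf_fms_le)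
  obtain \<theta> where theta: "\<theta> \<in> ?Y" "\<not> |{j \<in> ?J. \<psi> j = \<theta>}| \<le>o \<chi>\<^sub>0"
    by (rule large_fibre[OF _ Y Cinfinite_exp2_chi0 large chi0_le_exp2, of \<psi>]) (use psi in auto)
  obtain \<epsilon> where eJ: "\<And>i. i \<in> Field ?s \<Longrightarrow> \<epsilon> i \<in> {j \<in> ?J. \<psi> j = \<theta>}"
    and mono: "\<And>i j. (i, j) \<in> ?s \<Longrightarrow> i \<noteq> j \<Longrightarrow> (\<epsilon> i, \<epsilon> j) \<in> r \<and> \<epsilon> i \<noteq> \<epsilon> j"
    by (rule large_subset_cardSuc_embedding[OF Card_order_chi0 ch(1) _ theta(2)]) blast+
  have eJ1: "\<epsilon> i \<in> ?J" and eJ2: "\<psi> (\<epsilon> i) = \<theta>" if "i \<in> Field ?s" for i using eJ[OF that] by auto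
  \<comment> \<open>The parameters in \<open>P l\<close> are included for all indices, not only for
    those before \<open>j\<close>: when \<open>i\<close> is not earlier than \<open>j\<close>, the
    copy of \<open>b\<close> must still have the same type jointly with the parameters of
    \<open>i\<close>.\<close>
  define X where "X j = A \<union> (\<Union>i\<in>Field ?s. e (\<epsilon> i) ` param_vars (F (\<epsilon> i)) \<inter> P l) \<union>
    (\<lambda>i. a (\<epsilon> i)) ` underS ?s j" for j
  have XP: "X j \<subseteq> P (\<epsilon> j)" if "j \<in> Field ?s" for j
  proof -
    have "P l \<subseteq> P (\<epsilon> j)" using ch(2) eJ1[OF that] by blast
    moreover have "a (\<epsilon> i) \<in> P (\<epsilon> j)" if "i \<in> underS ?s j" for i
      using mono ch(3) that unfolding underS_def by blast
    ultimately show ?thesis using A(1) unfolding X_def by blast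
  qed
  have X_card: "|X j| \<le>o exp2_chi0" for j
    unfolding X_def
  proof (intro Un_Cinfinite_bound[OF _ _ Cinfinite_exp2_chi0] A(2) UNION_Cinfinite_bound[OF _ _ Cinfinite_exp2_chi0] ballI)
    show "|(\<lambda>i. a (\<epsilon> i)) ` underS ?s j| \<le>o exp2_chi0"
      by (rule ordLeq_transitive[OF card_of_image ordLeq_transitive[OF card_underS_cardSuc chi0_le_exp2]])
    show "|Field ?s| \<le>o exp2_chi0"
      by (rule ordIso_ordLeq_trans[OF card_of_Field_ordIso[OF cardSuc_Card_order[OF Card_order_chi0]] cardSuc_le_exp2])
    fix i assume i: "i \<in> Field ?s"
    show "|e (\<epsilon> i) ` param_vars (F (\<epsilon> i)) \<inter> P l| \<le>o exp2_chi0"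
      by (rule ordLeq_transitive[OF card_of_mono1[OF Int_lower1] ordLeq_transitive[OF card_of_image
          ordLeq_transitive[OF less_kap_le[OF card_param_vars[OF Q(1)[OF eJ1[OF i]]]] chi0_le_exp2]]])
  qed
  have "\<forall>j\<in>Field ?s. \<exists>b'. eqv N (X j) W b b' \<and> b' ` W \<subseteq> P (\<epsilon> j)"
  proof
    fix j assume j: "j \<in> Field ?s"
    have "saturated N (cardSuc (chi \<chi>\<^sub>0)) (P (\<epsilon> j))" using ch(5) eJ1[OF j] by blast
    from saturated_cardSuc_chi_eqv[OF this XP[OF j] X_card W, of b]
    show "\<exists>b'. eqv N (X j) W b b' \<and> b' ` W \<subseteq> P (\<epsilon> j)" by blast
  qed
  from bchoice[OF this] obtain B where
    B: "\<And>j. j \<in> Field ?s \<Longrightarrow> eqv N (X j) W b (B j) \<and> B j ` W \<subseteq> P (\<epsilon> j)" by blast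
  define u where "u i = case_sum (\<lambda>_::'k. a (\<epsilon> i)) (e (\<epsilon> i))" for i
  have "order_property N ?s"
  proof (rule order_propertyI[OF Card_order_kap theta(1)])
    fix i j assume ij: "i \<in> Field ?s" "j \<in> Field ?s"
    note iJ = eJ1[OF ij(1)]
    have orig: "sat N (case_sum (u i) b) \<theta> \<longleftrightarrow> ev (a (\<epsilon> i)) (e (\<epsilon> i)) (F (\<epsilon> i))"
      unfolding eJ2[OF ij(1), symmetric] \<psi>_def sat_map
    proof (rule sat_cong)
      fix v assume "v \<in> fm_vars (F (\<epsilon> i))"
      then show "(case_sum (u i) b \<circ> h (\<epsilon> i)) v = case_sum (\<lambda>_. a (\<epsilon> i)) (e (\<epsilon> i)) v"
        using outside[OF iJ] w(2) by (cases v rule: sum.exhaust) (auto simp: h_def u_def)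
    qed
    show "sat N (case_sum (u i) (B j)) \<theta> \<longleftrightarrow> (i, j) \<in> ?s \<and> i \<noteq> j"
    proof (cases "(i, j) \<in> ?s \<and> i \<noteq> j")
      case True
      have "sat N (case_sum (u i) b) \<theta> \<longleftrightarrow> sat N (case_sum (u i) (B j)) \<theta>"
      proof (rule eqv_sat[OF conjunct1[OF B[OF ij(2)]] theta(1)])
        fix v assume "v \<in> fm_vars \<theta>"
        then obtain x where x: "x \<in> fm_vars (F (\<epsilon> i))" "v = h (\<epsilon> i) x"
          unfolding eJ2[OF ij(1), symmetric] \<psi>_def fm.set_map by blast
        have "a (\<epsilon> i) \<in> X j" using True by (auto simp: X_def underS_def)
        moreover have "e (\<epsilon> i) s \<in> X j" if "Inr s \<in> fm_vars (F (\<epsilon> i))" "e (\<epsilon> i) s \<in> P l" for s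
          using that ij(1) unfolding X_def param_vars_def by blast
        ultimately show "(\<exists>y\<in>W. case_sum (u i) b v = b y \<and> case_sum (u i) (B j) v = B j y) \<or>
            case_sum (u i) b v = case_sum (u i) (B j) v \<and> case_sum (u i) b v \<in> X j"
          using x outside[OF iJ] w(1) by (cases x rule: sum.exhaust) (auto simp: h_def u_def)
      qed
      then show ?thesis using True orig Q(5)[OF iJ] by blast
    next
      case False
      then have "(j, i) \<in> ?s" using wo_rel.TOTALS[OF cardSuc_chi0_wo] ij by blast
      then have "(\<epsilon> j, \<epsilon> i) \<in> r \<or> \<epsilon> j = \<epsilon> i" using mono by blast
      then have "P (\<epsilon> j) \<subseteq> P (\<epsilon> i)" by (elim disjE) (auto dest: ch(2))
      then have BP: "B j ` W \<subseteq> P (\<epsilon> i)" using B[OF ij(2)] by blast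
      have lP: "P l \<subseteq> P (\<epsilon> i)" using ch(2) iJ by blast
      \<comment> \<open>\<open>e'\<close> is \<open>e (\<epsilon> i)\<close> with the part coming
        from \<open>b\<close> replaced by its copy. It lies in \<open>P (\<epsilon> i)\<close>,
        where \<open>a (\<epsilon> i)\<close> agrees with \<open>c\<close>, and has the type of
        \<open>g (\<epsilon> i)\<close> over \<open>A\<close>, so nonsplitting makes the formula
        false.\<close>
      define e' where "e' s = (if e (\<epsilon> i) s \<in> P l then e (\<epsilon> i) s else B j (w (e (\<epsilon> i) s)))" for s
      have e'P: "e' ` param_vars (F (\<epsilon> i)) \<subseteq> P (\<epsilon> i)"
        using BP lP w(1) outside[OF iJ] by (auto simp: e'_def param_vars_def)
      have "sat N (case_sum (u i) (B j)) \<theta> \<longleftrightarrow> ev (a (\<epsilon> i)) e' (F (\<epsilon> i))"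
        unfolding eJ2[OF ij(1), symmetric] \<psi>_def sat_map
      proof (rule sat_cong)
        fix v assume "v \<in> fm_vars (F (\<epsilon> i))"
        then show "(case_sum (u i) (B j) \<circ> h (\<epsilon> i)) v = case_sum (\<lambda>_. a (\<epsilon> i)) e' v"
          by (cases v rule: sum.exhaust) (auto simp: h_def u_def e'_def)
      qed
      also have "\<dots> \<longleftrightarrow> ev c e' (F (\<epsilon> i))"
        using same_type_ev[OF ch(4) Q(1)[OF iJ] e'P] iJ by blast
      also have "\<dots> \<longleftrightarrow> ev c (g (\<epsilon> i)) (F (\<epsilon> i))"
      proof (rule nonsplittingD[OF ns Q(1)[OF iJ]])
        show "e' ` param_vars (F (\<epsilon> i)) \<subseteq> (\<Union>i\<in>Field r. P i)" using e'P iJ by blast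
        show "g (\<epsilon> i) ` param_vars (F (\<epsilon> i)) \<subseteq> (\<Union>i\<in>Field r. P i)" using Q(3)[OF iJ] l by blast
        have "eqv N A (param_vars (F (\<epsilon> i))) (e (\<epsilon> i)) e'"
        proof (rule eqv_reindex[OF conjunct1[OF B[OF ij(2)]]])
          show "A \<subseteq> X j" by (auto simp: X_def)
          fix s assume s: "s \<in> param_vars (F (\<epsilon> i))"
          show "(\<exists>y\<in>W. e (\<epsilon> i) s = b y \<and> e' s = B j y) \<or> e (\<epsilon> i) s = e' s \<and> e (\<epsilon> i) s \<in> X j"
          proof (cases "e (\<epsilon> i) s \<in> P l")
            case True
            then have "e (\<epsilon> i) s \<in> X j" using s ij(1) unfolding X_def by blast
            then show ?thesis using True by (simp add: e'_def)
          next
            case False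
            then have "e (\<epsilon> i) s \<in> b ` W" using outside[OF iJ] s by (simp add: param_vars_def)
            from w[OF this] show ?thesis using False by (auto simp: e'_def intro!: bexI[of _ "w (e (\<epsilon> i) s)"])
          qed
        qed
        then show "eqv N A (param_vars (F (\<epsilon> i))) e' (g (\<epsilon> i))"
          using Q(4)[OF iJ] eqv_sym eqv_trans by blast
      qed
      finally show ?thesis using False Q(6)[OF iJ] by blast
    qed
  qed
  then show False using no_order_property by contradiction
qed

end

section \<open>Splitting-like notions\<close>

lemma saturated_len_mono: "saturated_len N \<mu> \<alpha> P \<Longrightarrow> \<mu>' \<le>o \<mu> \<Longrightarrow> saturated_len N \<mu>' \<alpha> P"
  unfolding saturated_len_def by (meson ordLess_ordLeq_trans)

text \<open>The predecessors of \<open>l\<close> number fewer than \<open>r\<close>; a final segment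
  of size below \<open>r\<close> would leave an infinite cardinal covered by two smaller
  sets.\<close>

lemma final_segment_large:
  assumes r: "Cinfinite r" and l: "l \<in> Field r"
  shows "\<not> |{j \<in> Field r. (l, j) \<in> r}| <o r"
proof
  assume "|{j \<in> Field r. (l, j) \<in> r}| <o r"
  moreover have co: "Card_order r" using r by blast
  moreover have "|underS r l| <o r" by (rule card_of_underS[OF co l])
  ultimately have "|{j \<in> Field r. (l, j) \<in> r} \<union> underS r l| <o r"
    using Un_Cinfinite_bound_strict r by blast
  moreover have "wo_rel r"
    using card_order_on_well_order_on[OF co] unfolding wo_rel_def .
  then have "Field r \<subseteq> {j \<in> Field r. (l, j) \<in> r} \<union> underS r l"
    using wo_rel.TOTALS[of r] l unfolding underS_def by blast
  then have "|Field r| \<le>o |{j \<in> Field r. (l, j) \<in> r} \<union> underS r l|" by (rule card_of_mono1)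
  ultimately have "|Field r| <o r" by (meson ordLeq_ordLess_trans)
  then show False
    using card_of_Field_ordIso[OF co] not_ordLess_ordIso by blast
qed

lemma card_csum_less:
  assumes "Cinfinite r" "r\<^sub>1 <o r" "r\<^sub>2 <o r" "Card_order r\<^sub>1" "Card_order r\<^sub>2"
  shows "r\<^sub>1 +c r\<^sub>2 <o r"
proof -
  have "|Field r\<^sub>1| <o r"
    by (rule ordIso_ordLess_trans[OF card_of_Field_ordIso[OF assms(4)] assms(2)])
  moreover have "|Field r\<^sub>2| <o r"
    by (rule ordIso_ordLess_trans[OF card_of_Field_ordIso[OF assms(5)] assms(3)])
  ultimately show ?thesis
    using card_of_Plus_ordLess_infinite_Field[of r "Field r\<^sub>1" "Field r\<^sub>2"] assms(1)
    by (simp add: csum_def cinfinite_def)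
qed

text \<open>A tuple over \<open>D\<close> is a function on an initial segment of \<kappa>, whose
  cardinality is one of the exponents in the supremum.\<close>

lemma card_tuples_le:
  assumes N: "Card_order (kap N)" and \<alpha>: "\<alpha> \<in> Field (kap N)" and D: "|D| \<le>o \<mu>" "Card_order \<mu>"
  shows "|tuples N \<alpha> D| \<le>o cexp_less \<mu> (kap N)"
proof -
  let ?U = "underS (kap N) \<alpha>"
  let ?f = "\<lambda>t x. if x \<in> ?U then the (t x) else undefined"
  have "inj_on ?f (tuples N \<alpha> D)"
  proof (rule inj_onI, rule ext)
    fix t t' x assume t: "t \<in> tuples N \<alpha> D" "t' \<in> tuples N \<alpha> D" "?f t = ?f t'"
    show "t x = t' x"
    proof (cases "x \<in> ?U")
      case True
      then have "x \<in> dom t" "x \<in> dom t'" using t(1,2) unfolding tuples_def by blast+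
      moreover have "the (t x) = the (t' x)" using fun_cong[OF t(3), of x] True by simp
      ultimately show ?thesis by auto
    next
      case False
      then have "x \<notin> dom t" "x \<notin> dom t'" using t(1,2) unfolding tuples_def by blast+
      then show ?thesis by (auto simp: dom_def)
    qed
  qed
  moreover have "?f ` tuples N \<alpha> D \<subseteq> Func ?U D"
  proof (rule image_subsetI)
    fix t assume t: "t \<in> tuples N \<alpha> D"
    have "the (t x) \<in> D" if "x \<in> ?U" for x
    proof -
      have "x \<in> dom t" using t that unfolding tuples_def by blast
      then obtain y where "t x = Some y" by blast
      then show ?thesis using t ranI[of t x y] unfolding tuples_def by auto
    qed
    then show "?f t \<in> Func ?U D" by (auto simp: Func_def)
  qed
  ultimately have "|tuples N \<alpha> D| \<le>o |Func ?U D|" unfolding card_of_ordLeq[symmetric] by blast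
  also have "|Func ?U D| =o |D| ^c |?U|" by (simp add: cexp_def Field_card_of card_of_refl)
  also have "|D| ^c |?U| \<le>o \<mu> ^c |?U|" by (rule cexp_mono1[OF D(1) card_of_Card_order])
  also have "\<mu> ^c |?U| \<le>o cexp_less \<mu> (kap N)"
    using is_sup_cexp_cexp_less[OF D(2) N] card_of_underS[OF N \<alpha>] card_of_Card_order
    unfolding is_sup_cexp_def by blast
  finally show ?thesis .
qed

lemma splitting_likeD:
  assumes "splitting_like N \<S> R"
  shows "A \<subseteq> A' \<Longrightarrow> A' \<subseteq> B\<^sub>0 \<Longrightarrow> B\<^sub>0 \<subseteq> B \<Longrightarrow> p \<in> all_types N B \<Longrightarrow> R p A \<Longrightarrow> R (restr p B\<^sub>0) A'"
    and "A \<subseteq> M \<Longrightarrow> M \<subseteq> B \<Longrightarrow> M \<in> \<S> \<Longrightarrow> saturated N (cardSuc ( |A| +c lang_card N)) M \<Longrightarrow>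
      q\<^sub>1 \<in> all_types N B \<Longrightarrow> q\<^sub>2 \<in> all_types N B \<Longrightarrow> R q\<^sub>1 A \<Longrightarrow> R q\<^sub>2 A \<Longrightarrow>
      restr q\<^sub>1 M = restr q\<^sub>2 M \<Longrightarrow> q\<^sub>1 = q\<^sub>2"
    and "A \<subseteq> B \<Longrightarrow> p \<in> all_types N B \<Longrightarrow> \<not> splits N p A \<Longrightarrow> R p A"
proof -
  note d = assms[unfolded splitting_like_def]
  show "A \<subseteq> A' \<Longrightarrow> A' \<subseteq> B\<^sub>0 \<Longrightarrow> B\<^sub>0 \<subseteq> B \<Longrightarrow> p \<in> all_types N B \<Longrightarrow> R p A \<Longrightarrow> R (restr p B\<^sub>0) A'"
    by (rule d[THEN conjunct1, rule_format]) (intro conjI; assumption)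
  show "A \<subseteq> M \<Longrightarrow> M \<subseteq> B \<Longrightarrow> M \<in> \<S> \<Longrightarrow> saturated N (cardSuc ( |A| +c lang_card N)) M \<Longrightarrow>
      q\<^sub>1 \<in> all_types N B \<Longrightarrow> q\<^sub>2 \<in> all_types N B \<Longrightarrow> R q\<^sub>1 A \<Longrightarrow> R q\<^sub>2 A \<Longrightarrow>
      restr q\<^sub>1 M = restr q\<^sub>2 M \<Longrightarrow> q\<^sub>1 = q\<^sub>2"
    by (rule d[THEN conjunct2, THEN conjunct1, rule_format]) (intro conjI; assumption)
  show "A \<subseteq> B \<Longrightarrow> p \<in> all_types N B \<Longrightarrow> \<not> splits N p A \<Longrightarrow> R p A"
    by (rule d[THEN conjunct2, THEN conjunct2, rule_format]) (intro conjI; assumption)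
qed

context no_long_order
begin

section \<open>Types of single elements and the notion \<open>splits\<close>\<close>

lemma sat_tp_one: "\<phi> \<in> qf_fms N ({pt} <+> X) \<Longrightarrow> sat N (case_sum (the \<circ> [pt \<mapsto> a]) id) \<phi> \<longleftrightarrow> ev a id \<phi>"
  by (rule sat_cong) (auto dest!: qf_fms_vars)

lemma tp_one: "tp N [pt \<mapsto> a] X = {\<phi> \<in> qf_fms N ({pt} <+> X). ev a id \<phi>}"
  using sat_tp_one[of _ X a] by (auto simp: tp_def)

lemma tp_one_in_types: "tp N [pt \<mapsto> a] X \<in> types N (one_len N) X"
  by (auto simp: types_def tuples_one_len)

lemma tp_one_in_all_types: "tp N [pt \<mapsto> a] X \<in> all_types N X"
  using tp_one_in_types one_len_in by (auto simp: all_types_def)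

text \<open>Both instances of a splitting formula belong to the type over \<open>X\<close>. This
  forces every parameter that occurs into \<open>X\<close> and every other variable to be
  \<open>pt\<close>, so the formula is in \<open>one_fms\<close> and \<open>nonsplitting\<close>
  applies.\<close>

lemma nonsplitting_not_splits:
  assumes ns: "nonsplitting a A X"
  shows "\<not> splits N (tp N [pt \<mapsto> a] X) A"
proof
  assume "splits N (tp N [pt \<mapsto> a] X) A"
  then obtain \<beta> \<phi> b b' where phi: "\<phi> \<in> qf_fms N (UNIV <+> underS (kap N) \<beta>)"
    and b: "b \<in> tuples N \<beta> UNIV" "b' \<in> tuples N \<beta> UNIV" and tp: "tp N b' A = tp N b A"
    and mem: "subst_params b \<phi> \<in> tp N [pt \<mapsto> a] X" "Neg (subst_params b' \<phi>) \<in> tp N [pt \<mapsto> a] X"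
    unfolding splits_def by blast
  have "fm_vars (subst_params b \<phi>) \<subseteq> {pt} <+> X" "fm_vars (subst_params b' \<phi>) \<subseteq> {pt} <+> X"
    using mem qf_fms_vars unfolding tp_one by fastforce+
  then have vars: "map_sum id (the \<circ> b) v \<in> {pt} <+> X" "map_sum id (the \<circ> b') v \<in> {pt} <+> X"
    if "v \<in> fm_vars \<phi>" for v using that by (auto simp: subst_params_def fm.set_map)
  have "fm_vars \<phi> \<subseteq> {pt} <+> Field (kap N)"
  proof
    fix v assume v: "v \<in> fm_vars \<phi>"
    then have "v \<in> UNIV <+> underS (kap N) \<beta>" using qf_fms_vars[OF phi] by blast
    then show "v \<in> {pt} <+> Field (kap N)"
      using vars(1)[OF v] underS_Field by fastforce
  qed
  then have phi1: "\<phi> \<in> one_fms" using qf_fms_restrict_vars[OF phi] by blast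
  have par: "param_vars \<phi> \<subseteq> underS (kap N) \<beta>"
    using qf_fms_vars[OF phi] by (auto simp: param_vars_def)
  have "(the \<circ> b) ` param_vars \<phi> \<subseteq> X" "(the \<circ> b') ` param_vars \<phi> \<subseteq> X"
    using vars by (fastforce simp: param_vars_def)+
  moreover have "eqv N A (param_vars \<phi>) (the \<circ> b) (the \<circ> b')"
    by (rule eqv_mono[OF iffD1[OF tp_eq_iff_eqv[OF b] tp[symmetric]] order_refl par])
  ultimately have "ev a (the \<circ> b) \<phi> \<longleftrightarrow> ev a (the \<circ> b') \<phi>" by (rule nonsplittingD[OF ns phi1])
  moreover have "case_sum (\<lambda>_::'k. a) id \<circ> map_sum (id :: 'k \<Rightarrow> 'k) f = case_sum (\<lambda>_. a) f" for f :: "'k \<Rightarrow> 'a"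
    by (auto simp: fun_eq_iff split: sum.splits)
  then have "ev a id (subst_params b \<phi>) \<longleftrightarrow> ev a (the \<circ> b) \<phi>"
    "ev a id (subst_params b' \<phi>) \<longleftrightarrow> ev a (the \<circ> b') \<phi>"
    by (simp_all only: subst_params_def sat_map)
  ultimately show False using mem unfolding tp_one by simp
qed

text \<open>
  A single \<open>a\<^sub>j\<close> whose type over \<open>P\<^sub>l b\<close> does not split over \<open>A'\<close> suffices: by uniqueness of
  \<open>R\<close>-nonsplitting extensions it has the same type as \<open>c\<close> there. Uniqueness is available only over members
  of \<open>\<S>\<close>, and there is no nonsplitting extension of a type unless some element realizes it.
\<close>
lemma exists_base:
  assumes chain: "realizing_chain (chi \<chi>\<^sub>0) P a c"
    and P: "\<And>i. i \<in> Field (chi \<chi>\<^sub>0) \<Longrightarrow> P i \<in> \<S> \<and> P i \<subseteq> M \<and> A \<subseteq> P i"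
    and A: "|A| \<le>o \<chi>\<^sub>0" and R: "splitting_like N \<S> R" "R (tp N [pt \<mapsto> c] M) A"
  obtains A' l where "l \<in> Field (chi \<chi>\<^sub>0)" "A' \<subseteq> P l" "|A'| \<le>o exp2_chi0" "nonsplitting c A' M"
proof -
  let ?r = "chi \<chi>\<^sub>0"
  let ?U = "\<Union>i\<in>Field ?r. P i"
  note ch = realizing_chainD[OF chain]
  have inf: "infinite (Field ?r)" using Cinfinite_chi by (simp add: cinfinite_def)
  have reg: "regularCard ?r" unfolding chi_eq by (rule regularCard_cardSuc[OF Cinfinite_exp2_chi0])
  \<comment> \<open>Regularity of the successor cardinal \<open>chi \<chi>\<^sub>0\<close>: a set of
    size at most \<open>exp2_chi0\<close> inside the union of the chain is caught by one
    member.\<close>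
  have cover: "\<exists>i\<in>Field ?r. X \<subseteq> P i" if "X \<subseteq> ?U" "|X| \<le>o exp2_chi0" for X
    by (rule regularCard_UNION[OF Card_order_chi reg _ that(1)])
      (use ch(2) that(2) less_chi_iff in \<open>auto simp: relChain_def\<close>)
  obtain A\<^sub>1 where A1: "A\<^sub>1 \<subseteq> ?U" "|A\<^sub>1| \<le>o exp2_chi0" "nonsplitting c A\<^sub>1 ?U"
  proof (rule small_base)
    fix X assume X: "X \<subseteq> ?U" "|X| \<le>o \<chi>\<^sub>0"
    obtain i where i: "i \<in> Field ?r" "X \<subseteq> P i"
      using cover[OF X(1) ordLeq_transitive[OF X(2) chi0_le_exp2]] by blast
    obtain j where j: "j \<in> Field ?r" "i \<noteq> j" "(i, j) \<in> ?r"
      using infinite_Card_order_limit[OF Card_order_chi inf i(1)] by blast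
    have "a i \<in> ?U" using ch(3)[OF j(3,2)] j(1) by blast
    moreover have "same_type N X (a i) c" by (rule eqv_mono[OF ch(4)[OF i(1)] i(2) order_refl])
    ultimately show "\<exists>a\<in>?U. same_type N X a c" by blast
  qed
  obtain l where l: "l \<in> Field ?r" "A\<^sub>1 \<subseteq> P l" using cover[OF A1(1,2)] by blast
  \<comment> \<open>The union joins two virtues: \<open>A\<close> gives the
    \<open>R\<close>-nonsplitting of the type of \<open>c\<close>, and \<open>A\<^sub>1\<close> its
    nonsplitting on the segment. Both persist over a larger base.\<close>
  define A' where "A' = A \<union> A\<^sub>1"
  have A'_card: "|A'| \<le>o exp2_chi0"
    unfolding A'_def
    by (rule Un_Cinfinite_bound[OF ordLeq_transitive[OF A chi0_le_exp2] A1(2) Cinfinite_exp2_chi0])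
  have A'P: "A' \<subseteq> P l" using P[OF l(1)] l(2) by (simp add: A'_def)
  have ns: "nonsplitting c A' ?U" by (rule nonsplitting_base_mono[OF A1(3)]) (simp add: A'_def)
  have large: "\<not> |{j \<in> Field ?r. (l, j) \<in> ?r}| \<le>o exp2_chi0"
    using final_segment_large[OF Cinfinite_chi l(1)] less_chi_iff by blast
  have "|A'| +c lang_card N \<le>o exp2_chi0"
    by (rule csum_cinfinite_bound[OF A'_card ordLeq_transitive[OF lang_card_le chi0_le_exp2]
          card_of_Card_order Card_order_lang_card Cinfinite_exp2_chi0])
  then have "|A'| +c lang_card N \<le>o ?r"
    using cardSuc_greater[OF Card_order_cexp] unfolding chi_eq
    by (meson ordLeq_ordLess_trans ordLess_imp_ordLeq)
  then have "cardSuc ( |A'| +c lang_card N) \<le>o cardSuc ?r"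
    using cardSuc_mono_ordLeq[OF Card_order_csum Card_order_chi] by blast
  then have sat: "saturated N (cardSuc ( |A'| +c lang_card N)) (P l)"
    by (rule saturated_mono[OF ch(5)[OF l(1)]])
  have transfer: "ev c b \<phi> \<longleftrightarrow> ev c g \<phi>"
    if phi: "\<phi> \<in> one_fms" and b: "b ` param_vars \<phi> \<subseteq> M" and g: "g ` param_vars \<phi> \<subseteq> P l"
      and e: "eqv N A' (param_vars \<phi>) b g" for \<phi> b g
  proof -
    let ?B = "P l \<union> b ` param_vars \<phi>"
    obtain j where j: "j \<in> Field ?r" "(l, j) \<in> ?r" and nsj: "nonsplitting (a j) A' ?B"
      using exists_nonsplitting[OF chain l(1) A'P A'_card ns card_param_vars[OF phi] large] by blast
    have PM: "P l \<subseteq> M" "P l \<in> \<S>" using P[OF l(1)] by auto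
    have BM: "?B \<subseteq> M" using PM(1) b by blast
    have aj: "same_type N (P l) (a j) c" by (rule eqv_mono[OF ch(4)[OF j(1)] ch(2)[OF j(2)] order_refl])
    note sl = splitting_likeD[OF R(1)]
    have A'B: "A' \<subseteq> ?B" and PB: "P l \<subseteq> ?B" using A'P by auto
    have "R (restr (tp N [pt \<mapsto> c] M) ?B) A'"
      by (rule sl(1)[OF _ A'B BM tp_one_in_all_types R(2)]) (simp add: A'_def)
    then have Rc: "R (tp N [pt \<mapsto> c] ?B) A'" by (simp only: restr_tp[OF BM])
    have Ra: "R (tp N [pt \<mapsto> a j] ?B) A'"
      by (rule sl(3)[OF A'B tp_one_in_all_types nonsplitting_not_splits[OF nsj]])
    have "restr (tp N [pt \<mapsto> c] ?B) (P l) = restr (tp N [pt \<mapsto> a j] ?B) (P l)"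
      unfolding restr_tp[OF PB] tp_one_eq_iff by (rule eqv_sym[OF aj])
    from sl(2)[OF A'P PB PM(2) sat tp_one_in_all_types tp_one_in_all_types Rc Ra this]
    have "tp N [pt \<mapsto> c] ?B = tp N [pt \<mapsto> a j] ?B" .
    then have same: "same_type N ?B c (a j)" by (simp add: tp_one_eq_iff)
    have "ev c b \<phi> \<longleftrightarrow> ev (a j) b \<phi>" by (rule same_type_ev[OF same phi]) blast
    also have "\<dots> \<longleftrightarrow> ev (a j) g \<phi>" by (rule nonsplittingD[OF nsj phi _ _ e]) (use g in blast)+
    also have "\<dots> \<longleftrightarrow> ev c g \<phi>" by (rule same_type_ev[OF aj phi g])
    finally show ?thesis .
  qed
  have "nonsplitting c A' M"
    unfolding nonsplitting_def
  proof (intro ballI allI impI, elim conjE)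
    fix \<phi> and b b' :: "'k \<Rightarrow> 'a"
    assume phi: "\<phi> \<in> one_fms" and b: "b ` param_vars \<phi> \<subseteq> M" "b' ` param_vars \<phi> \<subseteq> M"
      and e: "eqv N A' (param_vars \<phi>) b b'" and t: "ev c b \<phi>"
    \<comment> \<open>One copy inside \<open>P l\<close> serves for both \<open>b\<close> and
      \<open>b'\<close>, since they have the same type over \<open>A'\<close>.\<close>
    obtain g where g: "eqv N A' (param_vars \<phi>) b g" "g ` param_vars \<phi> \<subseteq> P l"
      by (rule saturated_cardSuc_chi_eqv[OF ch(5)[OF l(1)] A'P A'_card card_param_vars[OF phi]])
    show "ev c b' \<phi>"
      using transfer[OF phi b(1) g(2,1)] transfer[OF phi b(2) g(2) eqv_trans[OF eqv_sym[OF e] g(1)]] t by blast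
  qed
  with l(1) A'P A'_card show ?thesis by (rule that)
qed

text \<open>A formula over \<open>D\<close> is split into a shape in \<open>one_fms\<close> and a
  tuple over \<open>D\<close>. Shapes are then counted by \<open>exp2_chi0\<close> and tuples by
  \<open>cexp_less\<close>.\<close>

lemma not_same_type_witness:
  assumes "\<not> same_type N D x c"
  obtains \<phi> \<alpha> t where "\<phi> \<in> one_fms" "\<alpha> \<in> Field (kap N)" "t \<in> tuples N \<alpha> D"
    "(the \<circ> t) ` param_vars \<phi> \<subseteq> D" "ev x (the \<circ> t) \<phi> \<noteq> ev c (the \<circ> t) \<phi>"
proof -
  obtain \<theta> where th: "\<theta> \<in> qf_fms N ((UNIV :: unit set) <+> D)" "ev x id \<theta> \<noteq> ev c id \<theta>"
    using assms unfolding eqv_def by blast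
  let ?W = "param_vars \<theta>"
  have WD: "?W \<subseteq> D" using qf_fms_vars[OF th(1)] by (auto simp: param_vars_def)
  obtain \<alpha> h where a: "\<alpha> \<in> Field (kap N)" and h: "bij_betw h ?W (underS (kap N) \<alpha>)"
    by (rule card_less_bij_underS[OF Card_order_kap card_param_vars[OF th(1)]])
  define \<phi> where "\<phi> = map_fm (map_sum (\<lambda>_. pt) h) \<theta>"
  define t where "t s = (if s \<in> underS (kap N) \<alpha> then Some (inv_into ?W h s) else None)" for s
  have hW: "h w \<in> underS (kap N) \<alpha>" "the (t (h w)) = w" if "w \<in> ?W" for w
    using h that by (auto simp: bij_betw_def t_def)
  have inv: "inv_into ?W h s \<in> ?W" if "s \<in> underS (kap N) \<alpha>" for s
    using that h by (metis bij_betw_def inv_into_into)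
  have phi: "\<phi> \<in> one_fms"
    unfolding \<phi>_def
  proof (rule map_fm_in_qf_fms[OF th(1)], rule image_subsetI)
    fix v assume "v \<in> fm_vars \<theta>"
    then show "map_sum (\<lambda>_. pt) h v \<in> {pt} <+> Field (kap N)"
      using underS_Field[OF hW(1)] by (cases v rule: sum.exhaust) (auto simp: param_vars_def)
  qed
  have par: "param_vars \<phi> \<subseteq> h ` ?W"
  proof
    fix s assume "s \<in> param_vars \<phi>"
    then obtain v where "v \<in> fm_vars \<theta>" "Inr s = map_sum (\<lambda>_. pt) h v"
      unfolding \<phi>_def param_vars_def fm.set_map by blast
    then show "s \<in> h ` ?W" by (cases v rule: sum.exhaust) (auto simp: param_vars_def)
  qed
  have "t \<in> tuples N \<alpha> D"
    using inv WD by (auto simp: tuples_def t_def dom_def ran_def split: if_splits)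
  moreover have "(the \<circ> t) ` param_vars \<phi> \<subseteq> D"
  proof (rule image_subsetI)
    fix s assume "s \<in> param_vars \<phi>"
    then obtain w where "w \<in> ?W" "s = h w" using par by blast
    then show "(the \<circ> t) s \<in> D" using hW(2) WD by auto
  qed
  moreover have "ev y (the \<circ> t) \<phi> \<longleftrightarrow> ev y id \<theta>" for y
    unfolding \<phi>_def sat_map
  proof (rule sat_cong)
    fix v assume "v \<in> fm_vars \<theta>"
    then show "(case_sum (\<lambda>_. y) (the \<circ> t) \<circ> map_sum (\<lambda>_. pt) h) v = case_sum (\<lambda>_. y) id v"
      using hW(2) by (cases v rule: sum.exhaust) (auto simp: param_vars_def)
  qed
  ultimately show ?thesis using that phi a th(2) by metis
qed

text \<open>Each formula over \<open>D\<close> rules out at most \<open>\<chi>\<^sub>0\<close>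
  indices. Under the arithmetic hypothesis there are too few formulas to rule out a final segment of
  \<lambda>. Under stability some type over \<open>D\<close> is repeated by more than
  \<open>\<chi>\<^sub>0\<close> of the elements; a formula separating it from the type of
  \<open>c\<close> would have all their indices as exceptions.\<close>

lemma realized_in_chain:
  fixes lam :: "'l rel"
  assumes chain: "realizing_chain lam P a c" and l: "l \<in> Field lam"
    and A: "A \<subseteq> P l" "|A| \<le>o exp2_chi0" and ns: "nonsplitting c A M"
    and PM: "\<And>i. i \<in> Field lam \<Longrightarrow> P i \<subseteq> M"
    and lam: "Card_order lam" "chi \<chi>\<^sub>0 <o lam" and D: "D \<subseteq> M" "|D| <o lam"
    and arith: "(\<forall>\<mu>::'l rel. Card_order \<mu> \<and> \<mu> <o lam \<longrightarrow> cexp_less \<mu> (kap N) <o lam) \<or>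
         (\<forall>\<nu>::'l rel. Card_order \<nu> \<and> \<nu> <o lam \<longrightarrow>
            (\<exists>\<mu>::'l rel. Card_order \<mu> \<and> \<nu> \<le>o \<mu> \<and> \<mu> <o lam \<and> stable_in N \<mu>))"
  shows "\<exists>j\<in>Field lam. same_type N D (a j) c"
proof -
  have inf: "Cinfinite lam"
    by (rule Cinfinite_ordLeq_trans[OF Cinfinite_chi ordLess_imp_ordLeq[OF lam(2)] lam(1)])
  have exp2: "exp2_chi0 <o lam"
    using ordLess_transitive[OF cardSuc_greater[OF Card_order_cexp] lam(2)[unfolded chi_eq]] .
  let ?J = "{j \<in> Field lam. (l, j) \<in> lam}"
  let ?E = "\<lambda>\<phi> b. {j \<in> Field lam. (l, j) \<in> lam \<and> ev (a j) b \<phi> \<noteq> ev c b \<phi>}"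
  have E: "|?E \<phi> b| \<le>o \<chi>\<^sub>0" if "\<phi> \<in> one_fms" "b ` param_vars \<phi> \<subseteq> D" for \<phi> b
    by (rule few_exceptions[OF chain l A ns PM that(1)]) (use that(2) D(1) in blast)+
  have J_large: "\<not> |?J| <o lam" by (rule final_segment_large[OF inf l])
  from arith show ?thesis
  proof
    assume exp: "\<forall>\<mu>::'l rel. Card_order \<mu> \<and> \<mu> <o lam \<longrightarrow> cexp_less \<mu> (kap N) <o lam"
    from iffD1[OF internalize_ordLess D(2)] obtain \<mu> :: "'l rel" where mu: "|D| =o \<mu>" "\<mu> <o lam" by blast
    have co: "Card_order \<mu>" by (rule Card_order_ordIso2[OF card_of_Card_order mu(1)])
    define \<nu> where "\<nu> = exp2_chi0 +c cexp_less \<mu> (kap N)"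
    have co': "Card_order (cexp_less \<mu> (kap N))"
      using is_sup_cexp_cexp_less[OF co Card_order_kap] unfolding is_sup_cexp_def by blast
    have nu_lam: "\<nu> <o lam"
      unfolding \<nu>_def by (rule card_csum_less[OF inf exp2 _ Card_order_cexp co']) (use exp co mu(2) in blast)
    have exp2_nu: "exp2_chi0 \<le>o \<nu>" unfolding \<nu>_def by (rule ordLeq_csum1[OF Card_order_cexp])
    have nu: "Cinfinite \<nu>"
      by (rule Cinfinite_ordLeq_trans[OF Cinfinite_exp2_chi0 exp2_nu]) (simp add: \<nu>_def Card_order_csum)
    have chi0_nu: "\<chi>\<^sub>0 \<le>o \<nu>" by (rule ordLeq_transitive[OF chi0_le_exp2 exp2_nu])
    show ?thesis
    proof (rule ccontr)
      assume none: "\<not> ?thesis"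
      \<comment> \<open>The second condition keeps \<open>the\<close> away from undefined places, as
        a formula may have parameter variables outside the domain of \<open>t\<close>.\<close>
      let ?T = "\<lambda>\<phi> \<alpha>. {t \<in> tuples N \<alpha> D. (the \<circ> t) ` param_vars \<phi> \<subseteq> D}"
      have "?J \<subseteq> (\<Union>\<phi>\<in>one_fms. \<Union>\<alpha>\<in>Field (kap N). \<Union>t\<in>?T \<phi> \<alpha>. ?E \<phi> (the \<circ> t))" (is "_ \<subseteq> ?U")
      proof
        fix j assume j: "j \<in> ?J"
        then have "\<not> same_type N D (a j) c" using none by blast
        then obtain \<phi> \<alpha> t where "\<phi> \<in> one_fms" "\<alpha> \<in> Field (kap N)" "t \<in> tuples N \<alpha> D"
          "(the \<circ> t) ` param_vars \<phi> \<subseteq> D" "ev (a j) (the \<circ> t) \<phi> \<noteq> ev c (the \<circ> t) \<phi>"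
          by (rule not_same_type_witness)
        then show "j \<in> ?U" using j by blast
      qed
      then have "|?J| \<le>o |?U|" by (rule card_of_mono1)
      also have "|?U| \<le>o \<nu>"
      proof (intro UNION_Cinfinite_bound[OF _ _ nu] ballI)
        show "|one_fms| \<le>o \<nu>" by (rule ordLeq_transitive[OF card_one_fms exp2_nu])
        show "|Field (kap N)| \<le>o \<nu>" by (rule ordLeq_transitive[OF Field_kap_le chi0_nu])
        fix \<phi> \<alpha> assume phi: "\<phi> \<in> one_fms" and al: "\<alpha> \<in> Field (kap N)"
        have "|tuples N \<alpha> D| \<le>o \<nu>"
          unfolding \<nu>_def
          by (rule ordLeq_transitive[OF card_tuples_le[OF Card_order_kap al ordIso_imp_ordLeq[OF mu(1)] co]
                ordLeq_csum2[OF co']])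
        then show "|?T \<phi> \<alpha>| \<le>o \<nu>" by (rule ordLeq_transitive[OF card_of_mono1, rotated]) blast
        fix t assume "t \<in> ?T \<phi> \<alpha>"
        then show "|?E \<phi> (the \<circ> t)| \<le>o \<nu>" using ordLeq_transitive[OF E[OF phi] chi0_nu] by blast
      qed
      finally have "|?J| <o lam" using nu_lam by (rule ordLeq_ordLess_trans)
      then show False using J_large by contradiction
    qed
  next
    assume stab: "\<forall>\<nu>::'l rel. Card_order \<nu> \<and> \<nu> <o lam \<longrightarrow>
            (\<exists>\<mu>::'l rel. Card_order \<mu> \<and> \<nu> \<le>o \<mu> \<and> \<mu> <o lam \<and> stable_in N \<mu>)"
    have "exp2_chi0 +c |D| <o lam"
      by (rule card_csum_less[OF inf exp2 D(2) Card_order_cexp card_of_Card_order])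
    from iffD1[OF internalize_ordLess this]
    obtain \<nu> :: "'l rel" where nu: "exp2_chi0 +c |D| =o \<nu>" "\<nu> <o lam" by blast
    have "Card_order \<nu>" by (rule Card_order_ordIso2[OF Card_order_csum nu(1)])
    with stab nu(2) obtain \<mu> :: "'l rel" where mu: "Card_order \<mu>" "\<nu> \<le>o \<mu>" "\<mu> <o lam" "stable_in N \<mu>"
      by blast
    have sum_mu: "exp2_chi0 +c |D| \<le>o \<mu>" by (rule ordIso_ordLeq_trans[OF nu(1) mu(2)])
    have exp2_mu: "exp2_chi0 \<le>o \<mu>" by (rule ordLeq_transitive[OF ordLeq_csum1[OF Card_order_cexp] sum_mu])
    have "|D| \<le>o \<mu>" by (rule ordLeq_transitive[OF ordLeq_csum2[OF card_of_Card_order] sum_mu])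
    then have types: "|types N (one_len N) D| \<le>o \<mu>" using mu(4) unfolding stable_in_def by blast
    have mu_inf: "Cinfinite \<mu>" by (rule Cinfinite_ordLeq_trans[OF Cinfinite_exp2_chi0 exp2_mu mu(1)])
    have "\<not> |?J| \<le>o \<mu>" using J_large ordLeq_ordLess_trans[OF _ mu(3)] by blast
    then obtain y where y: "\<not> |{j \<in> ?J. tp N [pt \<mapsto> a j] D = y}| \<le>o \<chi>\<^sub>0"
      by (rule large_fibre[OF _ types mu_inf _ ordLeq_transitive[OF chi0_le_exp2 exp2_mu],
            of "\<lambda>j. tp N [pt \<mapsto> a j] D", rotated]) (auto intro: tp_one_in_types)
    then have "{j \<in> ?J. tp N [pt \<mapsto> a j] D = y} \<noteq> {}"
      using ordLess_imp_ordLeq[OF finite_Cinfinite_bound[OF finite.emptyI Cinfinite_chi0]] by metis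
    then obtain i where i: "i \<in> ?J" "tp N [pt \<mapsto> a i] D = y" by blast
    have "same_type N D (a i) c"
    proof (rule ccontr)
      assume "\<not> same_type N D (a i) c"
      then obtain \<phi> \<alpha> t where phi: "\<phi> \<in> one_fms" and t: "(the \<circ> t) ` param_vars \<phi> \<subseteq> D"
        "ev (a i) (the \<circ> t) \<phi> \<noteq> ev c (the \<circ> t) \<phi>"
        by (rule not_same_type_witness)
      have "{j \<in> ?J. tp N [pt \<mapsto> a j] D = y} \<subseteq> ?E \<phi> (the \<circ> t)"
      proof
        fix j assume j: "j \<in> {j \<in> ?J. tp N [pt \<mapsto> a j] D = y}"
        then have "same_type N D (a j) (a i)" using i(2) tp_one_eq_iff[of "a j" D "a i"] by simp
        from same_type_ev[OF this phi t(1)] show "j \<in> ?E \<phi> (the \<circ> t)" using t(2) j by blast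
      qed
      from ordLeq_transitive[OF card_of_mono1[OF this] E[OF phi t(1)]] show False using y by contradiction
    qed
    then show ?thesis using i(1) by blast
  qed
qed

end

section \<open>Saturation\<close>

lemma realizing_chain_subchain:
  assumes N: "no_long_order N \<chi>\<^sub>0" and chain: "no_long_order.realizing_chain N \<chi>\<^sub>0 r P a c"
    and e: "\<And>i. i \<in> Field r' \<Longrightarrow> e i \<in> Field r"
      "\<And>i j. (i, j) \<in> r' \<Longrightarrow> i \<noteq> j \<Longrightarrow> (e i, e j) \<in> r \<and> e i \<noteq> e j"
    and wo: "Well_order r'"
  shows "no_long_order.realizing_chain N \<chi>\<^sub>0 r' (P \<circ> e) (a \<circ> e) c"
proof -
  interpret no_long_order N \<chi>\<^sub>0 by (rule N)
  note ch = realizing_chainD[OF chain]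
  have "P (e i) \<subseteq> P (e j)" if "(i, j) \<in> r'" for i j
    by (cases "i = j") (use ch(2) e(2)[OF that] in auto)
  moreover have "a (e i) \<in> P (e j)" if "(i, j) \<in> r'" "i \<noteq> j" for i j
    using ch(3) e(2)[OF that] by blast
  ultimately show ?thesis
    unfolding realizing_chain_def using wo ch(4,5) e(1) by simp
qed

context no_long_order
begin

text \<open>The chain is taken inside the final segment from the index where the base
  \<open>A\<close> appears, so \<open>A\<close> lies in each of its models; \<open>final_seg\<close>
  is long enough to leave room for length \<lambda>.\<close>

lemma saturated_len_one:
  fixes lam :: "'l rel"
  assumes lam: "Card_order lam" "chi \<chi>\<^sub>0 <o lam"
    and arith: "(\<forall>\<mu>::'l rel. Card_order \<mu> \<and> \<mu> <o lam \<longrightarrow> cexp_less \<mu> (kap N) <o lam) \<or>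
         (\<forall>\<nu>::'l rel. Card_order \<nu> \<and> \<nu> <o lam \<longrightarrow>
            (\<exists>\<mu>::'l rel. Card_order \<mu> \<and> \<nu> \<le>o \<mu> \<and> \<mu> <o lam \<and> stable_in N \<mu>))"
    and seq: "\<And>q. q \<in> types N (one_len N) M \<Longrightarrow>
           \<exists>(\<delta> :: 'a rel) (Ms :: 'a \<Rightarrow> 'a set).
             limit_ord \<delta> \<and> lam \<le>o \<delta> \<and>
             (\<forall>i\<in>Field \<delta>. Ms i \<in> \<S>) \<and>
             (\<forall>i\<in>Field \<delta>. \<forall>j\<in>Field \<delta>. (i, j) \<in> \<delta> \<and> i \<noteq> j \<longrightarrow> Ms i \<subset> Ms j) \<and>
             M = (\<Union>i\<in>Field \<delta>. Ms i) \<and>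
             (\<forall>i\<in>Field \<delta>. saturated N (cardSuc (chi \<chi>\<^sub>0)) (Ms i) \<and>
                realizes N (Ms (wo_rel.suc \<delta> {i})) (one_len N) (Ms i) (restr q (Ms i))) \<and>
             (\<exists>R. splitting_like N \<S> R \<and>
                (\<exists>i\<in>Field \<delta>. lam \<le>o final_seg \<delta> i \<and>
                   (\<exists>A. A \<subseteq> Ms i \<and> |A| \<le>o \<chi>\<^sub>0 \<and> R q A)))"
  shows "saturated_len N lam (one_len N) M"
  unfolding saturated_len_def
proof (intro allI impI, elim conjE)
  fix D p assume D: "D \<subseteq> M" "|D| <o lam" and p: "p \<in> types N (one_len N) D"
  obtain c where c: "p = tp N [pt \<mapsto> c] D" using p by (auto simp: types_def tuples_one_len)
  let ?q = "tp N [pt \<mapsto> c] M"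
  obtain \<delta> :: "'a rel" and Ms R i\<^sub>0 A where lim: "limit_ord \<delta>"
    and Ms: "\<forall>i\<in>Field \<delta>. Ms i \<in> \<S>"
      "\<forall>i\<in>Field \<delta>. \<forall>j\<in>Field \<delta>. (i, j) \<in> \<delta> \<and> i \<noteq> j \<longrightarrow> Ms i \<subset> Ms j"
      "M = (\<Union>i\<in>Field \<delta>. Ms i)"
      "\<forall>i\<in>Field \<delta>. saturated N (cardSuc (chi \<chi>\<^sub>0)) (Ms i) \<and>
         realizes N (Ms (wo_rel.suc \<delta> {i})) (one_len N) (Ms i) (restr ?q (Ms i))"
    and R: "splitting_like N \<S> R" "R ?q A"
    and i0: "i\<^sub>0 \<in> Field \<delta>" "lam \<le>o final_seg \<delta> i\<^sub>0" and A: "A \<subseteq> Ms i\<^sub>0" "|A| \<le>o \<chi>\<^sub>0"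
    using seq[OF tp_one_in_types] by metis
  have wo: "wo_rel \<delta>" using lim by (simp add: limit_ord_def wo_rel_def)
  obtain e where e: "\<And>i. i \<in> Field lam \<Longrightarrow> e i \<in> Field (final_seg \<delta> i\<^sub>0)"
    "\<And>i j. (i, j) \<in> lam \<Longrightarrow> i \<noteq> j \<Longrightarrow> (e i, e j) \<in> final_seg \<delta> i\<^sub>0 \<and> e i \<noteq> e j"
    by (rule ordLeq_strict_embedding[OF i0(2)]) blast
  have seg: "final_seg \<delta> i\<^sub>0 \<subseteq> \<delta>" "Field (final_seg \<delta> i\<^sub>0) \<subseteq> above \<delta> i\<^sub>0"
    by (auto simp: final_seg_def Field_def)
  have e_above: "(i\<^sub>0, e i) \<in> \<delta>" "e i \<in> Field \<delta>" if "i \<in> Field lam" for i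
    using subsetD[OF seg(2) e(1)[OF that]] by (auto simp: above_def Field_def)
  have e_mono: "(e i, e j) \<in> \<delta>" "e i \<noteq> e j" if "(i, j) \<in> lam" "i \<noteq> j" for i j
    using e(2)[OF that] seg(1) by auto
  have Ms_mono: "Ms i \<subseteq> Ms j" if "(i, j) \<in> \<delta>" for i j
    using Ms(2) that FieldI1[OF that] FieldI2[OF that] by (cases "i = j") blast+
  have wo_lam: "Well_order lam" by (rule card_order_on_well_order_on[OF lam(1)])
  have "\<forall>i\<in>Field \<delta>. \<exists>x. x \<in> Ms (wo_rel.suc \<delta> {i}) \<and> same_type N (Ms i) x c"
  proof
    fix i assume i: "i \<in> Field \<delta>"
    then have "realizes N (Ms (wo_rel.suc \<delta> {i})) (one_len N) (Ms i) (restr ?q (Ms i))" using Ms(4) by blast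
    moreover have "restr ?q (Ms i) = tp N [pt \<mapsto> c] (Ms i)"
      by (rule restr_tp) (use Ms(3) i in blast)
    ultimately show "\<exists>x. x \<in> Ms (wo_rel.suc \<delta> {i}) \<and> same_type N (Ms i) x c"
      by (auto simp: realizes_def tuples_one_len tp_one_eq_iff)
  qed
  from bchoice[OF this] obtain x where
    x: "\<And>i. i \<in> Field \<delta> \<Longrightarrow> x i \<in> Ms (wo_rel.suc \<delta> {i}) \<and> same_type N (Ms i) (x i) c" by blast
  let ?P = "Ms \<circ> e" and ?a = "x \<circ> e"
  have chain: "realizing_chain lam ?P ?a c"
    unfolding realizing_chain_def
  proof (intro conjI allI impI ballI wo_lam)
    show "?P i \<subseteq> ?P j" if "(i, j) \<in> lam" for i j
      by (cases "i = j") (use Ms_mono e_mono that in auto)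
    show "?a i \<in> ?P j" if "(i, j) \<in> lam \<and> i \<noteq> j" for i j
    proof -
      have ij: "(e i, e j) \<in> \<delta>" "e i \<noteq> e j" using e_mono that by blast+
      then have "e j \<in> AboveS \<delta> {e i}" by (auto simp: AboveS_def Field_def)
      then have "(wo_rel.suc \<delta> {e i}, e j) \<in> \<delta>" by (rule wo_rel.suc_least_AboveS[OF wo])
      then have "Ms (wo_rel.suc \<delta> {e i}) \<subseteq> Ms (e j)" by (rule Ms_mono)
      then show ?thesis using x[OF FieldI1[OF ij(1)]] by auto
    qed
    show "same_type N (?P i) (?a i) c" if "i \<in> Field lam" for i
      using x[OF e_above(2)[OF that]] by simp
    show "saturated N (cardSuc (chi \<chi>\<^sub>0)) (?P i)" if "i \<in> Field lam" for i
      using Ms(4) e_above(2)[OF that] by simp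
  qed
  have PM: "?P i \<subseteq> M" if "i \<in> Field lam" for i
    using Ms(3) e_above(2)[OF that] by auto
  \<comment> \<open>The base is found along a subchain of length \<open>chi \<chi>\<^sub>0\<close>;
    the count of exceptions then uses the full chain from the index \<open>f l\<close> on.\<close>
  obtain f where f: "\<And>i. i \<in> Field (chi \<chi>\<^sub>0) \<Longrightarrow> f i \<in> Field lam"
    "\<And>i j. (i, j) \<in> chi \<chi>\<^sub>0 \<Longrightarrow> i \<noteq> j \<Longrightarrow> (f i, f j) \<in> lam \<and> f i \<noteq> f j"
    by (rule ordLeq_strict_embedding[OF ordLess_imp_ordLeq[OF lam(2)]]) blast
  have chain': "realizing_chain (chi \<chi>\<^sub>0) (?P \<circ> f) (?a \<circ> f) c"
    by (rule realizing_chain_subchain[OF no_long_order_axioms chain f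
        card_order_on_well_order_on[OF Card_order_chi]])
  have P': "(?P \<circ> f) i \<in> \<S> \<and> (?P \<circ> f) i \<subseteq> M \<and> A \<subseteq> (?P \<circ> f) i" if "i \<in> Field (chi \<chi>\<^sub>0)" for i
    using Ms(1) e_above[OF f(1)[OF that]] PM[OF f(1)[OF that]] A(1) Ms_mono[of i\<^sub>0 "e (f i)"] by auto
  obtain A' l where l: "l \<in> Field (chi \<chi>\<^sub>0)" and A': "A' \<subseteq> (?P \<circ> f) l" "|A'| \<le>o exp2_chi0" "nonsplitting c A' M"
    by (rule exists_base[OF chain' P' A(2) R])
  have "\<exists>j\<in>Field lam. same_type N D (?a j) c"
    by (rule realized_in_chain[OF chain f(1)[OF l] _ A'(2,3) PM lam D arith]) (use A'(1) in simp)
  then obtain j where j: "j \<in> Field lam" "same_type N D (?a j) c" by blast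
  \<comment> \<open>Since \<delta> is a limit, the successor of \<open>e j\<close> is bounded by an
    actual index, which places the realization in M.\<close>
  have "aboveS \<delta> (e j) \<noteq> {}" using lim e_above(2)[OF j(1)] unfolding limit_ord_def by blast
  then obtain k where k: "k \<noteq> e j" "(e j, k) \<in> \<delta>" unfolding aboveS_def by blast
  have kF: "k \<in> Field \<delta>" using k(2) by (rule FieldI2)
  have "k \<in> AboveS \<delta> {e j}" using k kF by (auto simp: AboveS_def)
  then have "Ms (wo_rel.suc \<delta> {e j}) \<subseteq> Ms k"
    by (intro Ms_mono wo_rel.suc_least_AboveS[OF wo])
  then have "?a j \<in> M" using x[OF e_above(2)[OF j(1)]] kF Ms(3) by auto
  moreover have "tp N [pt \<mapsto> ?a j] D = p" unfolding c using j(2) by (simp only: tp_one_eq_iff)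
  ultimately show "realizes N M (one_len N) D p"
    unfolding realizes_def tuples_one_len by blast
qed

end

theorem theorem5p30:
  fixes N :: "('k, 'f, 'r, 'a) struc"
    and \<S> :: "'a set set"
    and \<chi>\<^sub>0 :: "'c rel"
    and lam :: "'l rel"
    and M :: "'a set"
  assumes "infinitary_structure N"
    and "model_family N \<S>"
    and "one_types_suffice N \<S>"
    and "Card_order \<chi>\<^sub>0"
    and "lang_card N \<le>o \<chi>\<^sub>0"
    and "\<not> order_property N (cardSuc \<chi>\<^sub>0)"
    and "Card_order lam"
    and "chi \<chi>\<^sub>0 <o lam"
    and "(\<forall>\<mu>::'l rel. Card_order \<mu> \<and> \<mu> <o lam \<longrightarrow> cexp_less \<mu> (kap N) <o lam) \<or>
         (\<forall>\<nu>::'l rel. Card_order \<nu> \<and> \<nu> <o lam \<longrightarrow>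
            (\<exists>\<mu>::'l rel. Card_order \<mu> \<and> \<nu> \<le>o \<mu> \<and> \<mu> <o lam \<and> stable_in N \<mu>))"
    and "M \<in> \<S>"
    and "\<And>q. q \<in> types N (one_len N) M \<Longrightarrow>
           \<exists>(\<delta> :: 'a rel) (Ms :: 'a \<Rightarrow> 'a set).
             limit_ord \<delta> \<and> lam \<le>o \<delta> \<and>
             (\<forall>i\<in>Field \<delta>. Ms i \<in> \<S>) \<and>
             (\<forall>i\<in>Field \<delta>. \<forall>j\<in>Field \<delta>. (i, j) \<in> \<delta> \<and> i \<noteq> j \<longrightarrow> Ms i \<subset> Ms j) \<and>
             M = (\<Union>i\<in>Field \<delta>. Ms i) \<and>
             (\<forall>i\<in>Field \<delta>. saturated N (cardSuc (chi \<chi>\<^sub>0)) (Ms i) \<and>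
                realizes N (Ms (wo_rel.suc \<delta> {i})) (one_len N) (Ms i) (restr q (Ms i))) \<and>
             (\<exists>R. splitting_like N \<S> R \<and>
                (\<exists>i\<in>Field \<delta>. lam \<le>o final_seg \<delta> i \<and>
                   (\<exists>A. A \<subseteq> Ms i \<and> |A| \<le>o \<chi>\<^sub>0 \<and> R q A)))"
  shows "saturated N lam M"
proof -
  interpret no_long_order N \<chi>\<^sub>0
    using assms(1,4,5,6) by unfold_locales
  have one: "saturated_len N lam (one_len N) M"
    by (rule saturated_len_one[OF assms(7,8,9,11)])
  have inf: "Cinfinite lam"
    by (rule Cinfinite_ordLeq_trans[OF Cinfinite_chi ordLess_imp_ordLeq[OF assms(8)] assms(7)])
  have "lang_card N <o chi \<chi>\<^sub>0"
    unfolding chi_eq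
    by (rule ordLeq_ordLess_trans[OF ordLeq_transitive[OF lang_card_le chi0_le_exp2]
          cardSuc_greater[OF Card_order_cexp]])
  then have lang: "lang_card N <o lam" by (rule ordLess_transitive[OF _ assms(8)])
  show ?thesis
    unfolding saturated_def saturated_len_def
  proof (intro ballI allI impI, elim conjE)
    fix \<alpha> D p assume \<alpha>: "\<alpha> \<in> Field (kap N)" and D: "D \<subseteq> M" "|D| <o lam" "p \<in> types N \<alpha> D"
    \<comment> \<open>\<open>one_types_suffice\<close> quantifies over cardinals on one fixed type,
      which need not be that of \<lambda>. For each \<open>D\<close> this successor lives on that
      type, exceeds both \<open>|D|\<close> and \<open>lang_card N\<close>, and is at most
      \<lambda>.\<close>
    let ?\<mu> = "cardSuc ( |D| +c lang_card N)"
    have mu: "Card_order ?\<mu>" by (rule cardSuc_Card_order[OF Card_order_csum])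
    have sum: "|D| +c lang_card N <o ?\<mu>" by (rule cardSuc_greater[OF Card_order_csum])
    have "|D| +c lang_card N <o lam"
      by (rule card_csum_less[OF inf D(2) lang card_of_Card_order Card_order_lang_card])
    then have "?\<mu> \<le>o lam" by (rule cardSuc_least[OF Card_order_csum assms(7)])
    then have "saturated_len N ?\<mu> (one_len N) M" by (rule saturated_len_mono[OF one])
    moreover have "lang_card N <o ?\<mu>" by (rule ordLeq_ordLess_trans[OF ordLeq_csum2[OF Card_order_lang_card] sum])
    ultimately have "saturated N ?\<mu> M"
      using assms(3,10) mu unfolding one_types_suffice_def by blast
    moreover have "|D| <o ?\<mu>"
      by (rule ordLeq_ordLess_trans[OF ordLeq_csum1[OF card_of_Card_order] sum])
    ultimately show "realizes N M \<alpha> D p"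
      using \<alpha> D(1,3) unfolding saturated_def saturated_len_def by blast
  qed
qed

end
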